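(* For $n\in\mathbb N$, consider the matrix $$M=\left(\frac{(\alpha;q)_{j+k}}{(\alpha\beta;q)_{j+k}}\right)_{j,k=0}^{n}.$$ (1) Its determinant is $$\det M=\frac{\alpha^{n(n+1)/2}\,q^{n(n^2-1)/3}\ \prod_{m=1}^{n}(q,\alpha,\beta;q)_m}{\prod_{m=1}^{n}(\alpha\beta q^{m-1};q)_m\,(\alpha\beta;q)_{2m}}.$$ (2) Under the conditions $\alpha\neq0$, $q\neq0$, and $q,\alpha,\beta\neq q^{-k}$ for $k=0,\dots,n$, the matrix $M$ is invertible, and its inverse matrix $(\gamma_{j,k})_{j,k=0}^n$ has entries $$\gamma_{j,k}=\frac{(-1)^{j+k}q^{\binom{j+1}{2}+\binom{k+1}{2}}}{(\alpha;q)_j(\alpha;q)_k}\sum_{m=0}^{n}\frac{\left[\begin{array}{c}m\\ j\end{array}\right]_q\left[\begin{array}{c}m\\ k\end{array}\right]_q(\alpha\beta q^{m-1};q)_j\,(\alpha\beta q^{m-1};q)_k}{(\alpha q^{j+k})^m\,(q,\beta;q)_m\,(\alpha\beta;q)_{2m}\,(\alpha\beta q^{m-1};q)_m}.$$ (3) When $0<q,\alpha,\beta<1$, the matrix $M$ is positive definite, and its smallest eigenvalue $\lambda_s$ has the lower bound $$\lambda_s\ge\frac{(\alpha\beta;q)_\infty}{(\alpha;q)_\infty}\left\{\sum_{\ell=0}^{n}\frac{p_\ell^2(-1;\alpha q^{-1},\beta q^{-1}|q)}{h_\ell(\alpha q^{-1},\beta q^{-1}|q)}\right\}^{-1},$$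 where $$p_n(x;\alpha q^{-1},\beta q^{-1}|q)={}_2\phi_1\left(\begin{array}{c}q^{-n},\alpha\beta q^{n-1}\\ \alpha\end{array};q;qx\right)$$ and $$h_n(\alpha q^{-1},\beta q^{-1}|q)=\frac{(\alpha\beta;q)_\infty}{(\alpha;q)_\infty}\,\frac{(1-\alpha\beta q^{-1})\,(q,\beta;q)_n\,\alpha^n}{(1-\alpha\beta q^{2n-1})\,(\alpha,\alpha\beta q^{-1};q)_n}.$$
   Context: For $a\in\mathbb C$ and $q\in(0,1)$: $(a;q)_\infty=\prod_{m=0}^\infty(1-aq^m)$, $(a;q)_m=(a;q)_\infty/(aq^m;q)_\infty$ for $m\in\mathbb Z$, $(a_1,\dots,a_r;q)_m=\prod_{k=1}^r(a_k;q)_m$, and $\left[\begin{array}{c}m\\ j\end{array}\right]_q=\frac{(q;q)_m}{(q;q)_j(q;q)_{m-j}}$ for $0\le j\le m$, with $\left[\begin{array}{c}m\\ j\end{array}\right]_q=0$ for $j>m$. The basic hypergeometric function is ${}_2\phi_1\left(\begin{array}{c}a_1,a_2\\ b_1\end{array};q;z\right)=\sum_{k=0}^\infty\frac{(a_1,a_2;q)_k}{(q,b_1;q)_k}z^k$.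
   Formalization: In (2) the summand has (α;q)_m(αβ;q)_{2m} in the numerator instead of (αβ;q)_{2m} in the denominator (print fails at n=1); in (3) the prefactor is (α;q)_∞/(αβ;q)_∞ (print fails at n=0), and h_ℓ at αβ=q is its continuous value. αβ≠q^{-k}, k<2n, is made explicit. *)

theory Defs
  imports "HOL-Analysis.Infinite_Products" "Jordan_Normal_Form.Determinant" "Jordan_Normal_Form.Char_Poly"
begin

definition qpoch_inf :: "'a::real_normed_field \<Rightarrow> 'a \<Rightarrow> 'a"
  where "qpoch_inf a q = (\<Prod>i. 1 - a * q ^ i)"

text \<open>
  The finite product is used instead of the quotient of infinite products, which reads
  \<open>0 / 0\<close> for \<open>a = q\<^sup>-\<^sup>n\<close> and \<open>m \<le> n\<close>; the
  two agree whenever the denominator is nonzero, see \<open>qpoch_eq_quotient\<close> below.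
\<close>
definition qpoch :: "'a::real_normed_field \<Rightarrow> 'a \<Rightarrow> nat \<Rightarrow> 'a"
  where "qpoch a q m = (\<Prod>i<m. 1 - a * q ^ i)"

lemma qpoch_eq_quotient:
  fixes a q :: "'a::{real_normed_field,banach}"
  assumes q: "norm q < 1" and nz: "qpoch_inf (a * q ^ m) q \<noteq> 0"
  shows "qpoch a q m = qpoch_inf a q / qpoch_inf (a * q ^ m) q"
proof -
  have "summable (\<lambda>i. norm (- (a * q ^ i)))"
    using q by (simp add: norm_mult norm_power summable_mult summable_geometric)
  then have "abs_convergent_prod (\<lambda>i. 1 + - (a * q ^ i))"
    by (intro summable_imp_abs_convergent_prod) simp
  then have "convergent_prod (\<lambda>i. 1 - a * q ^ i)"
    using abs_convergent_prod_imp_convergent_prod by force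
  moreover have "(\<Prod>i. 1 - a * q ^ (i + m)) = qpoch_inf (a * q ^ m) q"
    by (simp add: qpoch_inf_def power_add mult_ac)
  ultimately have "qpoch_inf a q = qpoch a q m * qpoch_inf (a * q ^ m) q"
    unfolding qpoch_def qpoch_inf_def
    using has_prod_unique[OF has_prod_ignore_initial_segment'[of "\<lambda>i. 1 - a * q ^ i" m]]
    by simp
  then show ?thesis using nz by simp
qed

definition qbinom :: "nat \<Rightarrow> nat \<Rightarrow> 'a::real_normed_field \<Rightarrow> 'a"
  where "qbinom m j q =
    (if j \<le> m then qpoch q q m / (qpoch q q j * qpoch q q (m - j)) else 0)"

definition qhyp21 :: "'a::real_normed_field \<Rightarrow> 'a \<Rightarrow> 'a \<Rightarrow> 'a \<Rightarrow> 'a \<Rightarrow> 'a"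
  where "qhyp21 a1 a2 b1 q z =
    (\<Sum>k. (qpoch a1 q k * qpoch a2 q k) / (qpoch q q k * qpoch b1 q k) * z ^ k)"

definition qmat :: "'a::real_normed_field \<Rightarrow> 'a \<Rightarrow> 'a \<Rightarrow> nat \<Rightarrow> 'a mat"
  where "qmat \<alpha> \<beta> q n =
    Matrix.mat (n + 1) (n + 1) (\<lambda>(j, k). qpoch \<alpha> q (j + k) / qpoch (\<alpha> * \<beta>) q (j + k))"

text \<open>
  The weight of the \<open>m\<close>-th summand carries \<open>(\<alpha>; q)\<^sub>m (\<alpha>\<beta>; q)\<^sub>2\<^sub>m\<close>
  in the numerator. The printed formula has \<open>(\<alpha>\<beta>; q)\<^sub>2\<^sub>m\<close> in the denominator and
  no \<open>(\<alpha>; q)\<^sub>m\<close>, which is not the inverse already for \<open>n = 1\<close>.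
\<close>
definition qmat_inv_entry ::
    "'a::real_normed_field \<Rightarrow> 'a \<Rightarrow> 'a \<Rightarrow> nat \<Rightarrow> nat \<Rightarrow> nat \<Rightarrow> 'a"
  where "qmat_inv_entry \<alpha> \<beta> q n j k =
    (-1) ^ (j + k) * q ^ ((j + 1 choose 2) + (k + 1 choose 2)) / (qpoch \<alpha> q j * qpoch \<alpha> q k) *
    (\<Sum>m=0..n.
      (qbinom m j q * qbinom m k q *
        qpoch (\<alpha> * \<beta> * q powi (int m - 1)) q j * qpoch (\<alpha> * \<beta> * q powi (int m - 1)) q k *
        (qpoch \<alpha> q m * qpoch (\<alpha> * \<beta>) q (2 * m))) /
      ((\<alpha> * q ^ (j + k)) ^ m * (qpoch q q m * qpoch \<beta> q m) *
        qpoch (\<alpha> * \<beta> * q powi (int m - 1)) q m))"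

definition pos_def_mat :: "real mat \<Rightarrow> bool"
  where "pos_def_mat A \<longleftrightarrow> square_mat A \<and> transpose_mat A = A \<and>
    (\<forall>v \<in> carrier_vec (dim_row A). v \<noteq> 0\<^sub>v (dim_row A) \<longrightarrow> 0 < v \<bullet> (A *\<^sub>v v))"

definition is_smallest_eigenvalue :: "real mat \<Rightarrow> real \<Rightarrow> bool"
  where "is_smallest_eigenvalue A l \<longleftrightarrow> eigenvalue A l \<and> (\<forall>\<mu>. eigenvalue A \<mu> \<longrightarrow> l \<le> \<mu>)"

text \<open>
  Little \<open>q\<close>-Jacobi polynomials and their norms. With \<open>p\<^sub>n(x; a, b | q)\<close> and
  \<open>h\<^sub>n(a, b | q)\<close> in the usual parametrization, these are the values at
  \<open>a = \<alpha> / q\<close> and \<open>b = \<beta> / q\<close>.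
\<close>
definition lqj_poly :: "nat \<Rightarrow> real \<Rightarrow> real \<Rightarrow> real \<Rightarrow> real \<Rightarrow> real"
  where "lqj_poly n x \<alpha> \<beta> q =
    qhyp21 (q powi (- int n)) (\<alpha> * \<beta> * q powi (int n - 1)) \<alpha> q (q * x)"

text \<open>
  For \<open>\<alpha>\<beta> = q\<close> the generic formula reads \<open>0 / 0\<close>. The singularity is removable,
  and the first case is the value of the continuous extension (cancel the factor
  \<open>1 - \<alpha>\<beta> / q\<close>; see \<open>lqj_norm_cancelled\<close> below).

  The norms refer to a measure of total mass
  \<open>lqj_norm 0 \<alpha> \<beta> q = (\<alpha>\<beta>; q)\<^sub>\<infinity> / (\<alpha>; q)\<^sub>\<infinity>\<close>, the entries of
  \<open>qmat\<close> to its normalization. The bound for the smallest eigenvalue therefore has the factor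
  \<open>(\<alpha>; q)\<^sub>\<infinity> / (\<alpha>\<beta>; q)\<^sub>\<infinity>\<close>. Printed with the reciprocal factor,
  it would exceed the eigenvalue \<open>1\<close> for \<open>n = 0\<close>.
\<close>
definition lqj_norm :: "nat \<Rightarrow> real \<Rightarrow> real \<Rightarrow> real \<Rightarrow> real"
  where "lqj_norm n \<alpha> \<beta> q = qpoch_inf (\<alpha> * \<beta>) q / qpoch_inf \<alpha> q *
    (if \<alpha> * \<beta> = q then
       (if n = 0 then 1 else
         qpoch q q n * qpoch \<beta> q n * \<alpha> ^ n /
         ((1 - \<alpha> * \<beta> * q powi (2 * int n - 1)) * (qpoch \<alpha> q n * qpoch (\<alpha> * \<beta>) q (n - 1))))
     else
       (1 - \<alpha> * \<beta> * q powi (-1)) * (qpoch q q n * qpoch \<beta> q n) * \<alpha> ^ n /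
       ((1 - \<alpha> * \<beta> * q powi (2 * int n - 1)) *
         (qpoch \<alpha> q n * qpoch (\<alpha> * \<beta> * q powi (-1)) q n)))"

lemma lqj_norm_cancelled:
  assumes "q \<noteq> 0"
  shows "lqj_norm n \<alpha> \<beta> q = qpoch_inf (\<alpha> * \<beta>) q / qpoch_inf \<alpha> q *
    (if n = 0 then 1 else
      qpoch q q n * qpoch \<beta> q n * \<alpha> ^ n /
      ((1 - \<alpha> * \<beta> * q powi (2 * int n - 1)) * (qpoch \<alpha> q n * qpoch (\<alpha> * \<beta>) q (n - 1))))"
proof (cases "\<alpha> * \<beta> = q")
  case False
  define c where "c = 1 - \<alpha> * \<beta> * q powi (-1)"
  have c: "c \<noteq> 0" using False assms by (simp add: c_def field_simps)
  show ?thesis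
  proof (cases n)
    case 0
    then show ?thesis using False c by (simp add: lqj_norm_def c_def qpoch_def)
  next
    case (Suc k)
    have shift: "qpoch (\<alpha> * \<beta> * q powi (-1)) q n = c * qpoch (\<alpha> * \<beta>) q (n - 1)"
      using assms unfolding Suc qpoch_def prod.lessThan_Suc_shift
      by (simp add: c_def field_simps)
    show ?thesis
      unfolding lqj_norm_def if_not_P[OF False] shift c_def[symmetric] using c Suc by simp
  qed
qed (simp add: lqj_norm_def)

end

theory Submission
  imports Defs "Jordan_Normal_Form.Spectral_Radius"
begin

text \<open>
  Write \<open>\<mu>\<^sub>s = (\<alpha>;q)\<^sub>s / (\<alpha>\<beta>;q)\<^sub>s\<close>, so that \<open>M = (\<mu>\<^sub>j\<^sub>+\<^sub>k)\<close>, and let \<open>C\<close> be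
  the lower triangular matrix of coefficients of the little \<open>q\<close>-Jacobi polynomials.
  Orthogonality says that \<open>\<Sum>\<^sub>k C\<^sub>m\<^sub>k \<mu>\<^sub>k\<^sub>+\<^sub>s\<close> vanishes for \<open>s < m\<close> and has a closed form for
  \<open>s = m\<close>. Hence \<open>C M\<close> is upper triangular, which gives the determinant, and
  \<open>C M C\<^sup>T = D\<close> is diagonal, which gives \<open>M\<^sup>-\<^sup>1 = C\<^sup>T D\<^sup>-\<^sup>1 C\<close>. For \<open>0 < q, \<alpha>, \<beta> < 1\<close> the entries of
  \<open>D\<close> are positive, so \<open>M\<close> is positive definite, and the quadratic form of \<open>M\<^sup>-\<^sup>1\<close> at \<open>v\<close> is at most
  \<open>\<Sum>\<^sub>m (\<Sum>\<^sub>k \<bar>C\<^sub>m\<^sub>k\<bar>)\<^sup>2 / D\<^sub>m\<close> times \<open>v \<bullet> v\<close>. The signs of \<open>C\<^sub>m\<^sub>k\<close> alternate in \<open>k\<close>, so the inner sum is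
  the absolute value of the \<open>m\<close>-th polynomial at \<open>-1\<close>.
  Both moment evaluations are values of a \<open>q\<close>-analogue of the \<open>m\<close>-th finite difference on the
  grid \<open>1, q, q\<^sup>2, \<dots>\<close>, which satisfies a two-term recursion in \<open>m\<close>.
\<close>

declare sum.op_ivl_Suc [simp del] prod.op_ivl_Suc [simp del]

section \<open>A \<open>q\<close>-difference functional\<close>

lemma qpoch_0 [simp]: "qpoch a q 0 = 1"
  by (simp add: qpoch_def)

lemma qpoch_Suc: "qpoch a q (Suc m) = qpoch a q m * (1 - a * q ^ m)"
  by (simp add: qpoch_def)

lemma qpoch_add: "qpoch a q (m + n) = qpoch a q m * qpoch (a * q ^ m) q n"
  by (induction n) (simp_all add: qpoch_Suc power_add mult_ac)

text \<open>A shorter product divides a longer one. Hence the single condition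
  \<open>qpoch (\<alpha> * \<beta>) q (2 * n) \<noteq> 0\<close> covers all denominators of the
  matrix.\<close>

lemma qpoch_nonzero_mono: "qpoch a q n \<noteq> 0 \<Longrightarrow> m \<le> n \<Longrightarrow> qpoch a q m \<noteq> 0"
  using qpoch_add[of a q m "n - m"] by auto

lemma zero_choose_two [simp]: "0 choose 2 = (0::nat)"
  by (simp add: numeral_2_eq_2)

lemma choose_two_Suc: "Suc m choose 2 = m + (m choose 2)"
  by (simp add: numeral_2_eq_2)

lemma two_choose_two: "2 * (m choose 2) = m * (m - 1)"
  by (induction m) (auto simp: choose_two_Suc algebra_simps split: nat_diff_split)

lemma power_times_pred: "q ^ (m * (m - 1)) = q ^ (m choose 2) * q ^ (m choose 2)" for q :: "'a::monoid_mult"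
  by (metis two_choose_two mult_2 power_add)

lemma prod_power_lessThan: "(\<Prod>i<m. q ^ i) = q ^ (m choose 2)" for q :: "'a::comm_monoid_mult"
  by (induction m) (simp_all add: choose_two_Suc power_add mult_ac)

lemma qbinom_0:
  assumes "\<And>m. qpoch q q m \<noteq> 0"
  shows "qbinom m 0 q = 1"
  using assms by (simp add: qbinom_def)

lemma qbinom_self:
  assumes "\<And>m. qpoch q q m \<noteq> 0"
  shows "qbinom m m q = 1"
  using assms by (simp add: qbinom_def)

text \<open>The q-Pascal rule, in the variant that produces \<open>qdiff_Suc\<close>. The hypothesis
  says that no positive power of q is 1; it stands in for norm q < 1 in the algebraic part.\<close>

lemma qbinom_Suc_Suc:
  fixes q :: "'a::real_normed_field"
  assumes nz: "\<And>m. qpoch q q m \<noteq> 0"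
  shows "qbinom (Suc m) (Suc k) q = q ^ Suc k * qbinom m (Suc k) q + qbinom m k q"
proof -
  consider "k < m" | "k = m" | "m < k" by linarith
  then show ?thesis
  proof cases
    case 1
    then obtain d where m: "m = k + Suc d"
      using less_iff_Suc_add by auto
    have "1 - q * q ^ k \<noteq> 0" "1 - q * q ^ d \<noteq> 0" "1 - q * q ^ (k + Suc d) \<noteq> 0"
      using nz[of "Suc k"] nz[of "Suc d"] nz[of "Suc m"] by (simp_all add: qpoch_Suc m)
    then show ?thesis
      using nz[of k] nz[of d] nz[of m]
      by (simp add: qbinom_def m qpoch_Suc divide_simps) (simp add: algebra_simps power_add)
  next
    case 2
    then show ?thesis
      using qbinom_self[OF nz] by (simp add: qbinom_def nz)
  next
    case 3
    then show ?thesis by (simp add: qbinom_def)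
  qed
qed

text \<open>With (T f)(x) = f(q x), this is the value at 1 of (1 - T)(q - T)...(q^(m-1) - T) f;
  \<open>qdiff_Suc\<close> splits off the last factor.\<close>

definition qdiff :: "nat \<Rightarrow> 'a::real_normed_field \<Rightarrow> ('a \<Rightarrow> 'a) \<Rightarrow> 'a"
  where "qdiff m q f = (\<Sum>k\<le>m. (-1) ^ k * q ^ ((m - k) choose 2) * qbinom m k q * f (q ^ k))"

lemma qdiff_Suc:
  fixes q :: "'a::real_normed_field"
  assumes nz: "\<And>m. qpoch q q m \<noteq> 0"
  shows "qdiff (Suc m) q f = q ^ m * qdiff m q f - qdiff m q (\<lambda>x. f (q * x))"
proof -
  \<comment> \<open>The added index \<open>Suc m\<close> contributes nothing since its Gaussian
    binomial vanishes, whatever the truncated exponent is.\<close>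
  have "qdiff m q f = (\<Sum>k\<le>Suc m. (-1) ^ k * q ^ ((m - k) choose 2) * qbinom m k q * f (q ^ k))"
    by (simp add: qdiff_def qbinom_def)
  also have "q ^ m * \<dots> = q ^ (Suc m choose 2) * f 1 +
      (\<Sum>k\<le>m. (-1) ^ Suc k * q ^ ((m - k) choose 2) * (q ^ Suc k * qbinom m (Suc k) q) * f (q ^ Suc k))"
    unfolding sum.atMost_Suc_shift distrib_left sum_distrib_left
  proof (intro arg_cong2[where f = "(+)"] sum.cong refl)
    fix k assume "k \<in> {..m}"
    show "q ^ m * ((-1) ^ Suc k * q ^ (m - Suc k choose 2) * qbinom m (Suc k) q * f (q ^ Suc k)) =
      (-1) ^ Suc k * q ^ (m - k choose 2) * (q ^ Suc k * qbinom m (Suc k) q) * f (q ^ Suc k)"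
    proof (cases "Suc k \<le> m")
      case True
      then obtain d where d: "m = Suc k + d" using le_Suc_ex by blast
      show ?thesis by (simp add: d choose_two_Suc power_add mult_ac)
    qed (simp add: qbinom_def)
  qed (simp add: qbinom_0[OF nz] choose_two_Suc power_add mult_ac)
  finally have "q ^ m * qdiff m q f - qdiff m q (\<lambda>x. f (q * x)) = q ^ (Suc m choose 2) * f 1 +
      (\<Sum>k\<le>m. (-1) ^ Suc k * q ^ ((m - k) choose 2) *
        (q ^ Suc k * qbinom m (Suc k) q + qbinom m k q) * f (q ^ Suc k))"
    by (simp add: qdiff_def sum.distrib sum_negf sum_subtractf algebra_simps)
  then show ?thesis
    unfolding qdiff_def[of "Suc m"] sum.atMost_Suc_shift qbinom_Suc_Suc[OF nz]
    by (simp add: qbinom_0[OF nz])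
qed

lemma qdiff_0 [simp]: "qdiff 0 q f = f 1"
  by (simp add: qdiff_def qbinom_def)

lemma qdiff_add: "qdiff m q (\<lambda>x. f x + g x) = qdiff m q f + qdiff m q g"
  by (simp add: qdiff_def sum.distrib distrib_left)

lemma qdiff_cmult: "qdiff m q (\<lambda>x. c * f x) = c * qdiff m q f"
  by (simp add: qdiff_def sum_distrib_left mult_ac)

lemma qdiff_sum: "qdiff m q (\<lambda>x. \<Sum>i\<in>I. f i x) = (\<Sum>i\<in>I. qdiff m q (f i))"
  unfolding qdiff_def sum_distrib_left by (rule sum.swap)

text \<open>Monomials are eigenfunctions of the dilation T with eigenvalue q^r, so each operator
  factor becomes a number.\<close>

lemma qdiff_power:
  fixes q :: "'a::real_normed_field"
  assumes nz: "\<And>m. qpoch q q m \<noteq> 0"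
  shows "qdiff m q (\<lambda>x. x ^ r) = (\<Prod>i<m. q ^ i - q ^ r)"
proof (induction m)
  case (Suc m)
  show ?case
    unfolding qdiff_Suc[OF nz] power_mult_distrib qdiff_cmult Suc by (simp add: algebra_simps)
qed simp

text \<open>For r < m the factor i = r kills x^r, so only x^m survives. Taking
  \<open>coeff p m\<close> instead of the leading coefficient makes the same formula say that lower
  degrees are annihilated.\<close>

lemma qdiff_poly:
  fixes q :: "'a::real_normed_field"
  assumes nz: "\<And>m. qpoch q q m \<noteq> 0" and deg: "degree p \<le> m"
  shows "qdiff m q (poly p) = coeff p m * (q ^ (m choose 2) * qpoch q q m)"
proof -
  have low: "(\<Prod>i<m. q ^ i - q ^ r) = 0" if "r < m" for r
    using that by auto
  have top: "(\<Prod>i<m. q ^ i - q ^ m) = q ^ (m choose 2) * qpoch q q m"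
  proof -
    \<comment> \<open>Pulling out q^i leaves the factors of (q;q)_m in reverse order.\<close>
    have "(\<Prod>i<m. q ^ i - q ^ m) = (\<Prod>i<m. q ^ i * (1 - q * q ^ (m - Suc i)))"
    proof (intro prod.cong refl)
      fix i assume "i \<in> {..<m}"
      then have "m = i + Suc (m - Suc i)" by simp
      then have "q ^ m = q ^ i * (q * q ^ (m - Suc i))"
        by (metis power_add power_Suc)
      then show "q ^ i - q ^ m = q ^ i * (1 - q * q ^ (m - Suc i))"
        by (simp add: right_diff_distrib)
    qed
    also have "\<dots> = (\<Prod>i<m. q ^ i) * qpoch q q m"
      unfolding prod.distrib qpoch_def by (subst prod.nat_diff_reindex) simp
    finally show ?thesis by (simp only: prod_power_lessThan)
  qed
  have "poly p = (\<lambda>x. \<Sum>i\<le>m. coeff p i * x ^ i)"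
    unfolding poly_altdef using deg
    by (intro ext sum.mono_neutral_left) (auto simp: coeff_eq_0)
  then have "qdiff m q (poly p) = (\<Sum>i\<le>m. coeff p i * (\<Prod>j<m. q ^ j - q ^ i))"
    by (simp only: qdiff_sum qdiff_cmult qdiff_power[OF nz])
  also have "\<dots> = (\<Sum>i<m. coeff p i * (\<Prod>j<m. q ^ j - q ^ i)) + coeff p m * (\<Prod>j<m. q ^ j - q ^ m)"
    by (simp flip: lessThan_Suc_atMost)
  also have "(\<Sum>i<m. coeff p i * (\<Prod>j<m. q ^ j - q ^ i)) = 0"
    by (intro sum.neutral) (simp add: low)
  finally show ?thesis by (simp add: top)
qed

definition qpoch_poly :: "'a::real_normed_field \<Rightarrow> 'a \<Rightarrow> nat \<Rightarrow> 'a poly"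
  where "qpoch_poly a q m = (\<Prod>i<m. [:1, - a * q ^ i:])"

lemma poly_qpoch_poly: "poly (qpoch_poly a q m) x = qpoch (a * x) q m"
  by (simp add: qpoch_poly_def qpoch_def poly_prod algebra_simps)

lemma degree_qpoch_poly: "degree (qpoch_poly a q m) \<le> m"
proof -
  have "degree (qpoch_poly a q m) \<le> (\<Sum>i<m. degree [:1, - a * q ^ i:])"
    unfolding qpoch_poly_def using degree_prod_sum_le[of "{..<m}" "\<lambda>i. [:1, - a * q ^ i:]"] by (simp add: o_def)
  also have "\<dots> \<le> (\<Sum>i<m. 1)" by (intro sum_mono) simp
  finally show ?thesis by simp
qed

text \<open>Stated for index m rather than for the leading coefficient, because the degree drops
  below m when a = 0.\<close>

lemma coeff_qpoch_poly: "coeff (qpoch_poly a q m) m = (\<Prod>i<m. - a * q ^ i)"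
proof (induction m)
  case (Suc m)
  have "qpoch_poly a q (Suc m) = qpoch_poly a q m * [:1, - a * q ^ m:]"
    by (simp add: qpoch_poly_def)
  then have "coeff (qpoch_poly a q (Suc m)) (Suc m) =
      coeff (qpoch_poly a q m) (Suc m) - a * q ^ m * coeff (qpoch_poly a q m) m"
    by simp
  then show ?case
    using Suc coeff_eq_0[of "qpoch_poly a q m" "Suc m"] degree_qpoch_poly[of a q m] by simp
qed (simp add: qpoch_poly_def)

text \<open>Dilation replaces b by b q, so the recursion stays inside this family; the induction
  therefore keeps b arbitrary.\<close>

lemma qdiff_inverse_linear:
  fixes q :: "'a::real_normed_field"
  assumes nz: "\<And>m. qpoch q q m \<noteq> 0" and "qpoch b q (Suc m) \<noteq> 0"
  shows "qdiff m q (\<lambda>x. 1 / (1 - b * x)) = q ^ (m choose 2) * qpoch q q m * b ^ m / qpoch b q (Suc m)"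
  using assms(2)
proof (induction m arbitrary: b)
  case (Suc m)
  have shift: "qpoch b q (Suc n) = (1 - b) * qpoch (b * q) q n" for n
    using qpoch_add[of b q 1 n] by (simp add: qpoch_Suc)
  have nz1: "qpoch b q (Suc m) \<noteq> 0" "1 - b * q ^ Suc m \<noteq> 0"
    using Suc.prems by (auto simp: qpoch_Suc[of b q "Suc m"])
  have nz2: "1 - b \<noteq> 0" "qpoch (b * q) q (Suc m) \<noteq> 0"
    using Suc.prems unfolding shift by auto
  \<comment> \<open>Both denominators are pieces of (b;q)_(m+2) and differ only in its first and
    last factor.\<close>
  have eq: "qpoch (b * q) q (Suc m) = qpoch b q (Suc m) * (1 - b * q ^ Suc m) / (1 - b)"
    using nz2 shift[of "Suc m"] by (simp add: qpoch_Suc[of b q "Suc m"] field_simps)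
  let ?e = "q ^ (m choose 2) * qpoch q q m" and ?P = "qpoch b q (Suc m)"
  have "qdiff (Suc m) q (\<lambda>x. 1 / (1 - b * x)) =
      q ^ m * (?e * b ^ m / ?P) - ?e * (b * q) ^ m / qpoch (b * q) q (Suc m)"
    using Suc.IH[OF nz1(1)] Suc.IH[OF nz2(2)] by (simp add: qdiff_Suc[OF nz] mult_ac)
  also have "\<dots> = q ^ m * ?e * b ^ m * (b * (1 - q * q ^ m)) / (?P * (1 - b * q ^ Suc m))"
    unfolding eq using nz1 nz2(1)
    by (simp add: divide_simps power_mult_distrib) (simp add: algebra_simps)
  finally show ?case
    by (simp add: qpoch_Suc[of b q "Suc m"] qpoch_Suc[of q] choose_two_Suc power_add mult_ac)
qed (simp add: qpoch_Suc)

text \<open>For b nonzero, division by 1 - b x leaves a constant remainder, and the quotient is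
  annihilated. For b = 0 the fraction is itself a polynomial; keeping b inside the product gives one
  formula for both cases.\<close>

lemma qdiff_qpoch_div_linear:
  fixes q :: "'a::real_normed_field"
  assumes nz: "\<And>m. qpoch q q m \<noteq> 0" and b: "qpoch b q (Suc m) \<noteq> 0"
  shows "qdiff m q (\<lambda>x. qpoch (a * x) q m / (1 - b * x)) =
    q ^ (m choose 2) * qpoch q q m * (\<Prod>i<m. b - a * q ^ i) / qpoch b q (Suc m)"
proof (cases "b = 0")
  case True
  have "qdiff m q (\<lambda>x. qpoch (a * x) q m) = qdiff m q (poly (qpoch_poly a q m))"
    by (simp add: poly_qpoch_poly[abs_def])
  then show ?thesis
    using True by (simp add: qdiff_poly[OF nz degree_qpoch_poly] coeff_qpoch_poly qpoch_def[of 0] mult_ac)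
next
  case False
  have nz_b: "1 - b * q ^ k \<noteq> 0" if "k \<le> m" for k
    using b that by (auto simp: qpoch_def simp del: prod.lessThan_Suc)
  \<comment> \<open>Induction on the identity
    \<open>b F\<^sub>j\<^sub>+\<^sub>1 = (b - a q\<^sup>j) F\<^sub>j + a q\<^sup>j (a x;q)\<^sub>j\<close> for
    \<open>F\<^sub>j = (a x;q)\<^sub>j / (1 - b x)\<close>, whose last term is a polynomial of degree below \<open>m\<close>.\<close>
  have "j \<le> m \<Longrightarrow> b ^ j * qdiff m q (\<lambda>x. qpoch (a * x) q j / (1 - b * x)) =
    (\<Prod>i<j. b - a * q ^ i) * qdiff m q (\<lambda>x. 1 / (1 - b * x))" for j
  proof (induction j)
    case (Suc j)
    have z: "qdiff m q (\<lambda>x. qpoch (a * x) q j) = 0"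
    proof -
      have "qdiff m q (\<lambda>x. qpoch (a * x) q j) = qdiff m q (poly (qpoch_poly a q j))"
        by (simp add: poly_qpoch_poly[abs_def])
      then show ?thesis
        using Suc.prems degree_qpoch_poly[of a q j]
        by (subst (asm) qdiff_poly[OF nz]) (auto intro!: coeff_eq_0)
    qed
    have "b * qdiff m q (\<lambda>x. qpoch (a * x) q (Suc j) / (1 - b * x)) =
        qdiff m q (\<lambda>x. (b - a * q ^ j) * (qpoch (a * x) q j / (1 - b * x)) + a * q ^ j * qpoch (a * x) q j)"
      unfolding qdiff_cmult[symmetric] unfolding qdiff_def
    proof (intro sum.cong refl arg_cong[where f = "(*) _"])
      fix k assume "k \<in> {..m}"
      then show "b * (qpoch (a * q ^ k) q (Suc j) / (1 - b * q ^ k)) =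
        (b - a * q ^ j) * (qpoch (a * q ^ k) q j / (1 - b * q ^ k)) + a * q ^ j * qpoch (a * q ^ k) q j"
        using nz_b[of k] by (simp add: qpoch_Suc field_simps)
    qed
    also have "\<dots> = (b - a * q ^ j) * qdiff m q (\<lambda>x. qpoch (a * x) q j / (1 - b * x))"
      unfolding qdiff_add qdiff_cmult z by simp
    finally have step: "b * qdiff m q (\<lambda>x. qpoch (a * x) q (Suc j) / (1 - b * x)) =
      (b - a * q ^ j) * qdiff m q (\<lambda>x. qpoch (a * x) q j / (1 - b * x))" .
    let ?X = "\<lambda>j. qdiff m q (\<lambda>x. qpoch (a * x) q j / (1 - b * x))"
    have "b ^ Suc j * ?X (Suc j) = b ^ j * (b * ?X (Suc j))"
      by (simp only: power_Suc2 mult.assoc)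
    also have "\<dots> = (b - a * q ^ j) * (b ^ j * ?X j)"
      unfolding step by (rule mult.left_commute)
    also have "b ^ j * ?X j = (\<Prod>i<j. b - a * q ^ i) * qdiff m q (\<lambda>x. 1 / (1 - b * x))"
      using Suc by simp
    finally show ?case by (simp add: mult_ac)
  qed simp
  from this[of m] have "b ^ m * qdiff m q (\<lambda>x. qpoch (a * x) q m / (1 - b * x)) =
    b ^ m * (q ^ (m choose 2) * qpoch q q m * (\<Prod>i<m. b - a * q ^ i) / qpoch b q (Suc m))"
    unfolding qdiff_inverse_linear[OF nz b] by (simp add: mult_ac)
  then show ?thesis using False by (subst (asm) mult_left_cancel) simp_all
qed

section \<open>Orthogonality of the little \<open>q\<close>-Jacobi polynomials\<close>

text \<open>
  This is the \<open>k\<close>-th coefficient of the hypergeometric polynomial times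
  \<open>q\<^bsup>m choose 2\<^esup> (\<alpha>;q)\<^sub>m\<close>, see \<open>qjac_eq\<close> below. The factor clears all
  denominators, so the moment formulas also hold for \<open>\<alpha> = q\<^bsup>-i\<^esup>\<close>. The truncated
  \<open>m - 1\<close> for \<open>m = 0\<close> is harmless, since only \<open>k = 0\<close> contributes.
\<close>
definition qjac :: "'a::real_normed_field \<Rightarrow> 'a \<Rightarrow> 'a \<Rightarrow> nat \<Rightarrow> nat \<Rightarrow> 'a"
  where "qjac \<alpha> \<beta> q m k = (-1) ^ k * q ^ ((m - k) choose 2) * qbinom m k q *
    qpoch (\<alpha> * q ^ k) q (m - k) * qpoch (\<alpha> * \<beta> * q ^ (m - 1)) q k"

lemma qjac_eq_0: "m < k \<Longrightarrow> qjac \<alpha> \<beta> q m k = 0"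
  by (simp add: qjac_def qbinom_def)

text \<open>(\<alpha>;q)_k completes (\<alpha> q^k;q)_(m-k) to (\<alpha>;q)_m, which is free of k.
  What remains are the weights of \<open>qdiff\<close> and a function of q^k.\<close>

lemma qjac_moment:
  fixes q :: "'a::real_normed_field"
  assumes "k \<le> m"
  shows "qjac \<alpha> \<beta> q m k * (qpoch \<alpha> q (k + s) / qpoch (\<alpha> * \<beta>) q (k + s)) =
    qpoch \<alpha> q m * ((-1) ^ k * q ^ ((m - k) choose 2) * qbinom m k q *
      (qpoch (\<alpha> * q ^ k) q s * qpoch (\<alpha> * \<beta> * q ^ (m - 1)) q k / qpoch (\<alpha> * \<beta>) q (k + s)))"
  using assms qpoch_add[of \<alpha> q k "m - k"] by (simp add: qjac_def qpoch_add[of \<alpha>] mult_ac)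

text \<open>After cancellation the summand is a polynomial in q^k of degree at most m - 1, which
  \<open>qdiff m\<close> annihilates.\<close>

lemma qjac_orthogonal:
  fixes q :: "'a::real_normed_field"
  assumes nz: "\<And>m. qpoch q q m \<noteq> 0" and A: "qpoch (\<alpha> * \<beta>) q (2 * m) \<noteq> 0" and s: "s < m"
  shows "(\<Sum>k\<le>m. qjac \<alpha> \<beta> q m k * (qpoch \<alpha> q (k + s) / qpoch (\<alpha> * \<beta>) q (k + s))) = 0"
proof -
  let ?A = "\<alpha> * \<beta>"
  let ?p = "qpoch_poly \<alpha> q s * qpoch_poly (?A * q ^ s) q (m - 1 - s)"
  have "(\<Sum>k\<le>m. qjac \<alpha> \<beta> q m k * (qpoch \<alpha> q (k + s) / qpoch ?A q (k + s))) =
      (\<Sum>k\<le>m. qpoch \<alpha> q m * ((-1) ^ k * q ^ ((m - k) choose 2) * qbinom m k q *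
        (1 / qpoch ?A q (m - 1) * poly ?p (q ^ k))))"
  proof (intro sum.cong refl)
    fix k assume k: "k \<in> {..m}"
    have n1: "qpoch ?A q (m - 1) \<noteq> 0" "qpoch ?A q (k + s) \<noteq> 0"
      using A k s by (auto elim!: qpoch_nonzero_mono)
    \<comment> \<open>The product (\<alpha>\<beta>;q)_(k+m-1) is split in two ways, at m - 1 and at
      k + s; this trades the k-dependent denominator for a polynomial.\<close>
    have "qpoch ?A q (m - 1) * qpoch (?A * q ^ (m - 1)) q k = qpoch ?A q (k + s + (m - 1 - s))"
      using s by (subst qpoch_add[symmetric]) (simp add: algebra_simps)
    also have "\<dots> = qpoch ?A q (k + s) * qpoch (?A * q ^ (k + s)) q (m - 1 - s)"
      by (rule qpoch_add)
    finally have "qpoch (?A * q ^ (m - 1)) q k / qpoch ?A q (k + s) =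
        qpoch (?A * q ^ (k + s)) q (m - 1 - s) / qpoch ?A q (m - 1)"
      using n1 by (simp add: field_simps)
    then show "qjac \<alpha> \<beta> q m k * (qpoch \<alpha> q (k + s) / qpoch ?A q (k + s)) =
      qpoch \<alpha> q m * ((-1) ^ k * q ^ ((m - k) choose 2) * qbinom m k q *
        (1 / qpoch ?A q (m - 1) * poly ?p (q ^ k)))"
      using k by (subst qjac_moment)
        (auto simp: poly_qpoch_poly power_add mult_ac simp flip: times_divide_eq_right)
  qed
  also have "\<dots> = qpoch \<alpha> q m * (1 / qpoch ?A q (m - 1) * qdiff m q (poly ?p))"
    unfolding qdiff_cmult[symmetric] qdiff_def sum_distrib_left by simp
  also have "qdiff m q (poly ?p) = 0"
  proof -
    have "degree ?p \<le> s + (m - 1 - s)"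
      by (rule order.trans[OF degree_mult_le add_mono]) (rule degree_qpoch_poly)+
    then have "degree ?p < m" using s by simp
    then show ?thesis by (subst qdiff_poly[OF nz]) (auto simp: coeff_eq_0)
  qed
  finally show ?thesis by simp
qed

text \<open>The pairing of the m-th polynomial with x^m, a diagonal entry of C M.\<close>

definition qjac_top :: "'a::real_normed_field \<Rightarrow> 'a \<Rightarrow> 'a \<Rightarrow> nat \<Rightarrow> 'a"
  where "qjac_top \<alpha> \<beta> q m = (- \<alpha>) ^ m * q ^ (m * (m - 1)) *
    (qpoch q q m * qpoch \<alpha> q m * qpoch \<beta> q m) / qpoch (\<alpha> * \<beta>) q (2 * m)"

text \<open>For s = m the denominator keeps one linear factor after cancellation, so
  \<open>qdiff_qpoch_div_linear\<close> applies with b = \<alpha>\<beta> q^(m-1).\<close>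

lemma qjac_top_moment:
  fixes q :: "'a::real_normed_field"
  assumes nz: "\<And>m. qpoch q q m \<noteq> 0" and A: "qpoch (\<alpha> * \<beta>) q (2 * m) \<noteq> 0"
  shows "(\<Sum>k\<le>m. qjac \<alpha> \<beta> q m k * (qpoch \<alpha> q (k + m) / qpoch (\<alpha> * \<beta>) q (k + m))) =
    qjac_top \<alpha> \<beta> q m"
proof (cases m)
  case 0
  then show ?thesis by (simp add: qjac_top_def qjac_def qbinom_def)
next
  case (Suc r)
  let ?A = "\<alpha> * \<beta>"
  let ?b = "?A * q ^ r"
  have split: "qpoch ?A q (2 * m) = qpoch ?A q r * qpoch ?b q (Suc m)"
    by (subst qpoch_add[symmetric]) (simp add: Suc mult_2)
  have n1: "qpoch ?A q r \<noteq> 0" "qpoch ?b q (Suc m) \<noteq> 0"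
    using A unfolding split by auto
  have "(\<Sum>k\<le>m. qjac \<alpha> \<beta> q m k * (qpoch \<alpha> q (k + m) / qpoch ?A q (k + m))) =
      (\<Sum>k\<le>m. qpoch \<alpha> q m * ((-1) ^ k * q ^ ((m - k) choose 2) * qbinom m k q *
        (1 / qpoch ?A q r * (qpoch (\<alpha> * q ^ k) q m / (1 - ?b * q ^ k)))))"
  proof (intro sum.cong refl)
    fix k assume k: "k \<in> {..m}"
    have n2: "qpoch ?A q (k + m) \<noteq> 0"
      using A k by (auto elim!: qpoch_nonzero_mono)
    have eq: "qpoch ?A q (k + m) = qpoch ?A q r * qpoch ?b q k * (1 - ?b * q ^ k)"
    proof -
      have "qpoch ?A q (k + m) = qpoch ?A q (r + Suc k)" by (simp add: Suc add_ac)
      then show ?thesis by (simp add: qpoch_add qpoch_Suc mult_ac power_add)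
    qed
    have "qpoch (\<alpha> * q ^ k) q m * qpoch ?b q k / qpoch ?A q (k + m) =
        1 / qpoch ?A q r * (qpoch (\<alpha> * q ^ k) q m / (1 - ?b * q ^ k))"
      using n2 unfolding eq by (simp add: field_simps)
    moreover have "m - 1 = r" by (simp add: Suc)
    ultimately show "qjac \<alpha> \<beta> q m k * (qpoch \<alpha> q (k + m) / qpoch ?A q (k + m)) =
      qpoch \<alpha> q m * ((-1) ^ k * q ^ ((m - k) choose 2) * qbinom m k q *
        (1 / qpoch ?A q r * (qpoch (\<alpha> * q ^ k) q m / (1 - ?b * q ^ k))))"
      using k by (subst qjac_moment) simp_all
  qed
  also have "\<dots> = qpoch \<alpha> q m * (1 / qpoch ?A q r *
      qdiff m q (\<lambda>x. qpoch (\<alpha> * x) q m / (1 - ?b * x)))"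
    unfolding qdiff_cmult[symmetric] qdiff_def sum_distrib_left by simp
  also have "\<dots> = qpoch \<alpha> q m * (q ^ (m choose 2) * qpoch q q m * (\<Prod>i<m. ?b - \<alpha> * q ^ i)) / qpoch ?A q (2 * m)"
    unfolding qdiff_qpoch_div_linear[OF nz n1(2)] split by simp
  also have "(\<Prod>i<m. ?b - \<alpha> * q ^ i) = (-\<alpha>) ^ m * q ^ (m choose 2) * qpoch \<beta> q m"
  proof -
    \<comment> \<open>Extracting -\<alpha> q^i leaves 1 - \<beta> q^(m-1-i), the factors of
      (\<beta>;q)_m in reverse order.\<close>
    have "(\<Prod>i<m. ?b - \<alpha> * q ^ i) = (\<Prod>i<m. (-\<alpha>) * q ^ i * (1 - \<beta> * q ^ (m - Suc i)))"
    proof (intro prod.cong refl)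
      fix i assume "i \<in> {..<m}"
      then have "q ^ r = q ^ i * q ^ (m - Suc i)" by (simp add: Suc flip: power_add)
      then show "?b - \<alpha> * q ^ i = (-\<alpha>) * q ^ i * (1 - \<beta> * q ^ (m - Suc i))"
        by (simp add: algebra_simps)
    qed
    also have "\<dots> = (-\<alpha>) ^ m * (\<Prod>i<m. q ^ i) * qpoch \<beta> q m"
      unfolding prod.distrib qpoch_def by (subst (2) prod.nat_diff_reindex) simp
    finally show ?thesis by (simp only: prod_power_lessThan)
  qed
  also have "qpoch \<alpha> q m * (q ^ (m choose 2) * qpoch q q m * ((-\<alpha>) ^ m * q ^ (m choose 2) * qpoch \<beta> q m)) =
      (- \<alpha>) ^ m * q ^ (m * (m - 1)) * (qpoch q q m * qpoch \<alpha> q m * qpoch \<beta> q m)"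
    by (simp only: power_times_pred mult_ac)
  finally show ?thesis by (simp add: qjac_top_def)
qed

text \<open>The squared norm of the m-th polynomial, a diagonal entry of D: \<open>qjac_top\<close>
  times the leading coefficient, with the two signs (-1)^m cancelled.\<close>

definition qjac_norm :: "'a::real_normed_field \<Rightarrow> 'a \<Rightarrow> 'a \<Rightarrow> nat \<Rightarrow> 'a"
  where "qjac_norm \<alpha> \<beta> q m = \<alpha> ^ m * q ^ (m * (m - 1)) *
    (qpoch q q m * qpoch \<alpha> q m * qpoch \<beta> q m) * qpoch (\<alpha> * \<beta> * q ^ (m - 1)) q m /
    qpoch (\<alpha> * \<beta>) q (2 * m)"

lemma qjac_self:
  assumes "\<And>m. qpoch q q m \<noteq> 0"
  shows "qjac \<alpha> \<beta> q m m = (-1) ^ m * qpoch (\<alpha> * \<beta> * q ^ (m - 1)) q m"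
  by (simp add: qjac_def qbinom_self[OF assms])

lemma qjac_self_top:
  assumes "\<And>m. qpoch q q m \<noteq> 0"
  shows "qjac_top \<alpha> \<beta> q m * qjac \<alpha> \<beta> q m m = qjac_norm \<alpha> \<beta> q m"
proof -
  have "(- \<alpha>) ^ m * (-1) ^ m = \<alpha> ^ m"
    by (simp flip: power_mult_distrib)
  then show ?thesis
    by (simp add: qjac_top_def qjac_norm_def qjac_self[OF assms] mult_ac)
qed

section \<open>Comparison with the classical coefficients and the entries of the inverse\<close>

lemma choose_two_diff:
  assumes "j \<le> m"
  shows "((m - j) choose 2) + j * m = (m choose 2) + (Suc j choose 2)"
proof -
  obtain d where "m = j + d" using assms le_Suc_ex by blast
  moreover have "(d choose 2) + j * (j + d) = ((j + d) choose 2) + (Suc j choose 2)"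
    by (induction j) (simp_all add: choose_two_Suc)
  ultimately show ?thesis by simp
qed

lemma qjac_eq:
  fixes q :: "'a::real_normed_field"
  assumes "q \<noteq> 0" "qpoch \<alpha> q m \<noteq> 0" "k \<le> m"
  shows "qjac \<alpha> \<beta> q m k = q ^ (m choose 2) * qpoch \<alpha> q m *
    ((-1) ^ k * q ^ (Suc k choose 2) * qbinom m k q * qpoch (\<alpha> * \<beta> * q ^ (m - 1)) q k /
      (q ^ (k * m) * qpoch \<alpha> q k))"
proof -
  have "qpoch \<alpha> q m = qpoch \<alpha> q k * qpoch (\<alpha> * q ^ k) q (m - k)"
    using assms(3) by (simp flip: qpoch_add)
  then have "qpoch (\<alpha> * q ^ k) q (m - k) = qpoch \<alpha> q m / qpoch \<alpha> q k"
    using assms(2) by auto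
  moreover have "q ^ ((m - k) choose 2) * q ^ (k * m) = q ^ (m choose 2) * q ^ (Suc k choose 2)"
    by (simp add: choose_two_diff[OF assms(3)] flip: power_add)
  then have "q ^ ((m - k) choose 2) = q ^ (m choose 2) * q ^ (Suc k choose 2) / q ^ (k * m)"
    using assms(1) by (simp add: field_simps)
  ultimately show ?thesis
    by (simp add: qjac_def)
qed

text \<open>The right side is an entry of C^T D^(-1) C. By \<open>qjac_eq\<close> the two
  coefficients contribute q^(m(m-1)) and (\<alpha>;q)_m squared; division by the norm removes the
  power and one factor (\<alpha>;q)_m, and brings (\<alpha>\<beta>;q)_(2m) into the
  numerator.\<close>

lemma qmat_inv_entry_eq:
  fixes q :: "'a::real_normed_field"
  assumes q: "q \<noteq> 0" "\<And>m. qpoch q q m \<noteq> 0" and A: "qpoch (\<alpha> * \<beta>) q (2 * n) \<noteq> 0"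
    and \<alpha>: "\<alpha> \<noteq> 0" "qpoch \<alpha> q n \<noteq> 0" and \<beta>: "qpoch \<beta> q n \<noteq> 0"
  shows "qmat_inv_entry \<alpha> \<beta> q n j k =
    (\<Sum>m=0..n. qjac \<alpha> \<beta> q m j * qjac \<alpha> \<beta> q m k / qjac_norm \<alpha> \<beta> q m)"
  unfolding qmat_inv_entry_def sum_distrib_left
proof (intro sum.cong refl)
  fix m assume m: "m \<in> {0..n}"
  let ?B = "\<alpha> * \<beta> * q powi (int m - 1)" and ?b = "\<alpha> * \<beta> * q ^ (m - 1)"
  have nz: "qpoch \<alpha> q m \<noteq> 0" "qpoch \<beta> q m \<noteq> 0" "qpoch (\<alpha> * \<beta>) q (2 * m) \<noteq> 0"
    using m by (auto intro!: qpoch_nonzero_mono[OF \<alpha>(2)] qpoch_nonzero_mono[OF \<beta>] qpoch_nonzero_mono[OF A])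
  show "(-1) ^ (j + k) * q ^ ((j + 1 choose 2) + (k + 1 choose 2)) / (qpoch \<alpha> q j * qpoch \<alpha> q k) *
      (qbinom m j q * qbinom m k q * qpoch ?B q j * qpoch ?B q k *
        (qpoch \<alpha> q m * qpoch (\<alpha> * \<beta>) q (2 * m)) /
        ((\<alpha> * q ^ (j + k)) ^ m * (qpoch q q m * qpoch \<beta> q m) * qpoch ?B q m)) =
    qjac \<alpha> \<beta> q m j * qjac \<alpha> \<beta> q m k / qjac_norm \<alpha> \<beta> q m"
  proof (cases "j \<le> m \<and> k \<le> m")
    case False
    then show ?thesis by (auto simp: qbinom_def qjac_eq_0)
  next
    case True
    \<comment> \<open>For m = 0 the exponents -1 and the truncated 0 disagree, but then i = 0 and
      both products are empty.\<close>
    have B: "qpoch ?B q i = qpoch ?b q i" if "i \<le> m" for i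
    proof (cases m)
      case 0
      then show ?thesis using that by simp
    next
      case (Suc r)
      then show ?thesis by simp
    qed
    have jk: "(\<alpha> * q ^ (j + k)) ^ m = \<alpha> ^ m * (q ^ (j * m) * q ^ (k * m))"
      by (simp add: power_mult_distrib power_add power_mult)
    have sc: "j + 1 = Suc j" "k + 1 = Suc k" by simp_all
    show ?thesis
      using True nz q \<alpha>(1) unfolding jk sc qjac_norm_def power_times_pred
      by (simp add: qjac_eq[OF q(1) nz(1)] B power_add divide_simps)
  qed
qed

section \<open>Determinant and inverse\<close>

definition qjac_mat :: "'a::real_normed_field \<Rightarrow> 'a \<Rightarrow> 'a \<Rightarrow> nat \<Rightarrow> 'a mat"
  where "qjac_mat \<alpha> \<beta> q n = Matrix.mat (Suc n) (Suc n) (\<lambda>(m, k). qjac \<alpha> \<beta> q m k)"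

lemma qmat_carrier [simp]: "qmat \<alpha> \<beta> q n \<in> carrier_mat (Suc n) (Suc n)"
  by (simp add: qmat_def)

lemma qjac_mat_carrier [simp]: "qjac_mat \<alpha> \<beta> q n \<in> carrier_mat (Suc n) (Suc n)"
  by (simp add: qjac_mat_def)

lemma transpose_qmat: "transpose_mat (qmat \<alpha> \<beta> q n) = qmat \<alpha> \<beta> q n"
  by (auto simp: qmat_def add.commute)

lemma qjac_mat_mult_qmat:
  fixes q :: "'a::real_normed_field"
  assumes nz: "\<And>m. qpoch q q m \<noteq> 0" and A: "qpoch (\<alpha> * \<beta>) q (2 * n) \<noteq> 0"
    and "s \<le> m" "m \<le> n"
  shows "(qjac_mat \<alpha> \<beta> q n * qmat \<alpha> \<beta> q n) $$ (m, s) = (if s = m then qjac_top \<alpha> \<beta> q m else 0)"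
proof -
  have A': "qpoch (\<alpha> * \<beta>) q (2 * m) \<noteq> 0"
    using qpoch_nonzero_mono[OF A] assms(4) by simp
  have "(qjac_mat \<alpha> \<beta> q n * qmat \<alpha> \<beta> q n) $$ (m, s) =
      (\<Sum>k=0..<Suc n. qjac \<alpha> \<beta> q m k * (qpoch \<alpha> q (k + s) / qpoch (\<alpha> * \<beta>) q (k + s)))"
    using assms by (simp add: qjac_mat_def qmat_def scalar_prod_def)
  also have "\<dots> = (\<Sum>k\<le>m. qjac \<alpha> \<beta> q m k * (qpoch \<alpha> q (k + s) / qpoch (\<alpha> * \<beta>) q (k + s)))"
    using assms by (intro sum.mono_neutral_right) (auto simp: qjac_eq_0)
  finally show ?thesis
    using qjac_orthogonal[OF nz A', of s] qjac_top_moment[OF nz A'] assms(3) by auto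
qed

text \<open>Both C and C M are triangular, so the determinant is a quotient of diagonal products.
  Only the diagonal of C must be nonzero; the diagonal of C M may vanish.\<close>

lemma det_qmat:
  fixes q :: "'a::real_normed_field"
  assumes nz: "\<And>m. qpoch q q m \<noteq> 0" and A: "qpoch (\<alpha> * \<beta>) q (2 * n) \<noteq> 0"
  shows "Determinant.det (qmat \<alpha> \<beta> q n) =
    (\<Prod>m=1..n. \<alpha> ^ m * q ^ (m * (m - 1)) * (qpoch q q m * qpoch \<alpha> q m * qpoch \<beta> q m) /
      (qpoch (\<alpha> * \<beta> * q ^ (m - 1)) q m * qpoch (\<alpha> * \<beta>) q (2 * m)))"
proof -
  let ?C = "qjac_mat \<alpha> \<beta> q n" and ?M = "qmat \<alpha> \<beta> q n"
  have CM: "?C * ?M \<in> carrier_mat (Suc n) (Suc n)"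
    by (rule mult_carrier_mat[OF qjac_mat_carrier qmat_carrier])
  have B: "qpoch (\<alpha> * \<beta> * q ^ (m - 1)) q m \<noteq> 0" if "m \<le> n" for m
  proof -
    have "qpoch (\<alpha> * \<beta>) q ((m - 1) + m) \<noteq> 0"
      using that by (intro qpoch_nonzero_mono[OF A]) simp
    then show ?thesis unfolding qpoch_add by simp
  qed
  have "upper_triangular (?C * ?M)"
    using CM qjac_mat_mult_qmat[OF nz A] unfolding upper_triangular_def by auto
  then have "Determinant.det (?C * ?M) = (\<Prod>m=0..<Suc n. (?C * ?M) $$ (m, m))"
    using det_upper_triangular[OF _ CM] CM by (simp add: prod_list_diag_prod del: index_mult_mat)
  also have "\<dots> = (\<Prod>m=0..<Suc n. qjac_top \<alpha> \<beta> q m)"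
    by (intro prod.cong refl) (simp add: qjac_mat_mult_qmat[OF nz A] del: index_mult_mat)
  finally have 1: "Determinant.det ?C * Determinant.det ?M = (\<Prod>m=0..<Suc n. qjac_top \<alpha> \<beta> q m)"
    by (simp add: det_mult[of _ "Suc n"])
  have 2: "Determinant.det ?C = (\<Prod>m=0..<Suc n. qjac \<alpha> \<beta> q m m)"
    by (subst det_lower_triangular[of "Suc n"])
      (auto simp: prod_list_diag_prod qjac_mat_def qjac_eq_0)
  have nz2: "(\<Prod>m=0..<Suc n. qjac \<alpha> \<beta> q m m) \<noteq> 0"
    using B by (simp add: qjac_self[OF nz] del: prod.op_ivl_Suc)
  have "Determinant.det ?M = (\<Prod>m=0..<Suc n. qjac_top \<alpha> \<beta> q m / qjac \<alpha> \<beta> q m m)"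
    unfolding prod_dividef using 1 nz2 unfolding 2 by (simp add: field_simps del: prod.op_ivl_Suc)
  \<comment> \<open>The quotient for m = 0 equals 1.\<close>
  also have "\<dots> = (\<Prod>m=1..n. qjac_top \<alpha> \<beta> q m / qjac \<alpha> \<beta> q m m)"
    by (rule prod.mono_neutral_right) (auto simp: qjac_top_def qjac_self[OF nz] not_le)
  also have "\<dots> = (\<Prod>m=1..n. \<alpha> ^ m * q ^ (m * (m - 1)) * (qpoch q q m * qpoch \<alpha> q m * qpoch \<beta> q m) /
      (qpoch (\<alpha> * \<beta> * q ^ (m - 1)) q m * qpoch (\<alpha> * \<beta>) q (2 * m)))"
  proof (intro prod.cong refl)
    fix m
    have "(- \<alpha>) ^ m = \<alpha> ^ m * (-1) ^ m"
      by (simp flip: power_mult_distrib)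
    then show "qjac_top \<alpha> \<beta> q m / qjac \<alpha> \<beta> q m m =
      \<alpha> ^ m * q ^ (m * (m - 1)) * (qpoch q q m * qpoch \<alpha> q m * qpoch \<beta> q m) /
      (qpoch (\<alpha> * \<beta> * q ^ (m - 1)) q m * qpoch (\<alpha> * \<beta>) q (2 * m))"
      by (simp add: qjac_top_def qjac_self[OF nz] mult_ac)
  qed
  finally show ?thesis .
qed

lemma sum_times_pred: "(\<Sum>m=1..n. m * (m - 1)) = n * (n ^ 2 - 1) div (3::nat)"
proof -
  have "3 * (\<Sum>m=1..n. m * (m - 1)) = n * (n ^ 2 - 1)"
  proof (induction n)
    case IH: (Suc n)
    \<comment> \<open>The factorization removes the truncated subtraction before the
      algebra.\<close>
    have sq: "(Suc r)\<^sup>2 - 1 = r * (r + 2)" for r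
      by (simp add: power2_eq_square)
    show ?case
    proof (cases n)
      case (Suc r)
      show ?thesis
        using IH.IH unfolding Suc sq by (simp add: algebra_simps)
    qed simp
  qed simp
  then show ?thesis by (metis nonzero_mult_div_cancel_left zero_neq_numeral)
qed

lemma det_qmat_closed:
  fixes q :: "'a::real_normed_field"
  assumes nz: "\<And>m. qpoch q q m \<noteq> 0" and A: "qpoch (\<alpha> * \<beta>) q (2 * n) \<noteq> 0"
  shows "Determinant.det (qmat \<alpha> \<beta> q n) =
    \<alpha> ^ (n * (n + 1) div 2) * q ^ (n * (n ^ 2 - 1) div 3) *
    (\<Prod>m=1..n. qpoch q q m * qpoch \<alpha> q m * qpoch \<beta> q m) /
    (\<Prod>m=1..n. qpoch (\<alpha> * \<beta> * q powi (int m - 1)) q m * qpoch (\<alpha> * \<beta>) q (2 * m))"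
proof -
  have 1: "(\<Prod>m=1..n. \<alpha> ^ m) = \<alpha> ^ (n * (n + 1) div 2)"
  proof -
    have "(\<Sum>m=1..n. m) = n * (n + 1) div 2" by (induction n) auto
    then show ?thesis by (simp only: flip: power_sum)
  qed
  have 2: "(\<Prod>m=1..n. q ^ (m * (m - 1))) = q ^ (n * (n ^ 2 - 1) div 3)"
    by (simp only: sum_times_pred flip: power_sum)
  have 3: "q powi (int m - 1) = q ^ (m - 1)" if "m \<in> {1..n}" for m
    using that by (simp add: power_int_def nat_diff_distrib)
  show ?thesis
    unfolding det_qmat[OF nz A] prod_dividef prod.distrib 1 2 by (simp add: 3 prod.distrib)
qed

text \<open>On and below the diagonal, C M being upper and C^T being upper triangular leaves at most
  the term s = i = j. Symmetry of M supplies the other half.\<close>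

lemma qjac_gram:
  fixes q :: "'a::real_normed_field"
  assumes nz: "\<And>m. qpoch q q m \<noteq> 0" and A: "qpoch (\<alpha> * \<beta>) q (2 * n) \<noteq> 0"
  shows "qjac_mat \<alpha> \<beta> q n * qmat \<alpha> \<beta> q n * transpose_mat (qjac_mat \<alpha> \<beta> q n) =
    Matrix.mat (Suc n) (Suc n) (\<lambda>(i, j). if i = j then qjac_norm \<alpha> \<beta> q i else 0)"
proof -
  let ?C = "qjac_mat \<alpha> \<beta> q n" and ?M = "qmat \<alpha> \<beta> q n"
  let ?G = "?C * ?M * transpose_mat ?C"
  have CM: "?C * ?M \<in> carrier_mat (Suc n) (Suc n)"
    by (rule mult_carrier_mat[OF qjac_mat_carrier qmat_carrier])
  have G: "?G \<in> carrier_mat (Suc n) (Suc n)"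
    by (rule mult_carrier_mat[OF CM]) simp
  have low: "?G $$ (i, j) = (if i = j then qjac_norm \<alpha> \<beta> q i else 0)" if ij: "j \<le> i" "i \<le> n" for i j
  proof -
    have "?G $$ (i, j) = (\<Sum>s=0..<Suc n. (?C * ?M) $$ (i, s) * qjac \<alpha> \<beta> q j s)"
      using ij CM by (auto simp: scalar_prod_def qjac_mat_def intro!: sum.cong)
    \<comment> \<open>The intersection is a singleton for i = j and empty otherwise, which treats
      both cases at once.\<close>
    also have "\<dots> = (\<Sum>s\<in>{i} \<inter> {j}. qjac_top \<alpha> \<beta> q i * qjac \<alpha> \<beta> q j s)"
    proof (rule sum.mono_neutral_cong_right)
      show "\<forall>s\<in>{0..<Suc n} - {i} \<inter> {j}. (?C * ?M) $$ (i, s) * qjac \<alpha> \<beta> q j s = 0"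
      proof
        fix s assume s: "s \<in> {0..<Suc n} - {i} \<inter> {j}"
        show "(?C * ?M) $$ (i, s) * qjac \<alpha> \<beta> q j s = 0"
        proof (cases "s \<le> j")
          case True
          then show ?thesis
            using s ij by (subst qjac_mat_mult_qmat[OF nz A]) auto
        qed (simp add: qjac_eq_0)
      qed
    qed (use ij in \<open>auto simp: qjac_mat_mult_qmat[OF nz A] simp del: index_mult_mat\<close>)
    finally show ?thesis by (auto simp: qjac_self_top[OF nz])
  qed
  have sym: "transpose_mat ?G = ?G"
  proof -
    have "transpose_mat ?G = ?C * transpose_mat (?C * ?M)"
      by (subst transpose_mult[OF CM, of _ "Suc n"]) simp_all
    also have "\<dots> = ?C * (?M * transpose_mat ?C)"
      by (subst transpose_mult[of _ "Suc n" "Suc n" _ "Suc n"]) (simp_all add: transpose_qmat)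
    also have "\<dots> = ?G"
      by (subst assoc_mult_mat[of _ "Suc n" "Suc n" _ "Suc n" _ "Suc n"]) simp_all
    finally show ?thesis .
  qed
  show ?thesis
  proof (rule eq_matI)
    fix i j
    assume "i < dim_row (Matrix.mat (Suc n) (Suc n) (\<lambda>(i, j). if i = j then qjac_norm \<alpha> \<beta> q i else 0))"
      and "j < dim_col (Matrix.mat (Suc n) (Suc n) (\<lambda>(i, j). if i = j then qjac_norm \<alpha> \<beta> q i else 0))"
    then have ij: "i < Suc n" "j < Suc n" by simp_all
    have "?G $$ (i, j) = ?G $$ (j, i)"
      using arg_cong[OF sym, of "\<lambda>X. X $$ (i, j)"] ij G by (simp del: index_mult_mat)
    then show "?G $$ (i, j) =
      Matrix.mat (Suc n) (Suc n) (\<lambda>(i, j). if i = j then qjac_norm \<alpha> \<beta> q i else 0) $$ (i, j)"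
      using low[of i j] low[of j i] ij by (cases "j \<le> i") (auto simp del: index_mult_mat)
  qed (use G in auto)
qed

definition qmat_inv :: "'a::real_normed_field \<Rightarrow> 'a \<Rightarrow> 'a \<Rightarrow> nat \<Rightarrow> 'a mat"
  where "qmat_inv \<alpha> \<beta> q n = Matrix.mat (Suc n) (Suc n) (\<lambda>(j, k). qmat_inv_entry \<alpha> \<beta> q n j k)"

lemma qmat_inv_carrier [simp]: "qmat_inv \<alpha> \<beta> q n \<in> carrier_mat (Suc n) (Suc n)"
  by (simp add: qmat_inv_def)

lemma qjac_norm_nonzero:
  fixes q :: "'a::real_normed_field"
  assumes q: "q \<noteq> 0" "\<And>m. qpoch q q m \<noteq> 0" and A: "qpoch (\<alpha> * \<beta>) q (2 * n) \<noteq> 0"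
    and \<alpha>: "\<alpha> \<noteq> 0" "qpoch \<alpha> q n \<noteq> 0" and \<beta>: "qpoch \<beta> q n \<noteq> 0" and m: "m \<le> n"
  shows "qjac_norm \<alpha> \<beta> q m \<noteq> 0"
proof -
  have "qpoch (\<alpha> * \<beta>) q ((m - 1) + m) \<noteq> 0"
    using m by (intro qpoch_nonzero_mono[OF A]) simp
  then have "qpoch (\<alpha> * \<beta> * q ^ (m - 1)) q m \<noteq> 0" unfolding qpoch_add by simp
  moreover have "qpoch \<alpha> q m \<noteq> 0" "qpoch \<beta> q m \<noteq> 0" "qpoch (\<alpha> * \<beta>) q (2 * m) \<noteq> 0"
    using m by (auto intro!: qpoch_nonzero_mono[OF \<alpha>(2)] qpoch_nonzero_mono[OF \<beta>] qpoch_nonzero_mono[OF A])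
  ultimately show ?thesis using q \<alpha> by (simp add: qjac_norm_def)
qed

text \<open>From C M C^T = D it follows that M C^T D^(-1) is a right inverse of the square matrix C,
  hence also a left inverse; so C^T D^(-1) C inverts M. Here \<open>E\<close> is D^(-1).\<close>

lemma qmat_inv_eq:
  fixes q :: "'a::real_normed_field"
  assumes q: "q \<noteq> 0" "\<And>m. qpoch q q m \<noteq> 0" and A: "qpoch (\<alpha> * \<beta>) q (2 * n) \<noteq> 0"
    and \<alpha>: "\<alpha> \<noteq> 0" "qpoch \<alpha> q n \<noteq> 0" and \<beta>: "qpoch \<beta> q n \<noteq> 0"
  defines "C \<equiv> qjac_mat \<alpha> \<beta> q n"
    and "E \<equiv> Matrix.mat (Suc n) (Suc n) (\<lambda>(i, j). if i = j then 1 / qjac_norm \<alpha> \<beta> q i else 0)"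
  shows "qmat_inv \<alpha> \<beta> q n = transpose_mat C * E * C"
    and "qmat \<alpha> \<beta> q n * qmat_inv \<alpha> \<beta> q n = 1\<^sub>m (Suc n)"
    and "qmat_inv \<alpha> \<beta> q n * qmat \<alpha> \<beta> q n = 1\<^sub>m (Suc n)"
proof -
  let ?M = "qmat \<alpha> \<beta> q n" and ?h = "qjac_norm \<alpha> \<beta> q"
  have C [simp]: "C \<in> carrier_mat (Suc n) (Suc n)" and E [simp]: "E \<in> carrier_mat (Suc n) (Suc n)"
    by (simp_all add: C_def E_def)
  have CE [simp]: "transpose_mat C * E \<in> carrier_mat (Suc n) (Suc n)"
    by (rule mult_carrier_mat[of _ _ "Suc n"]) simp_all
  have CE_entry: "(transpose_mat C * E) $$ (j, m) = qjac \<alpha> \<beta> q m j / ?h m" if "j < Suc n" "m < Suc n" for j m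
  proof -
    have "(transpose_mat C * E) $$ (j, m) =
        (\<Sum>i=0..<Suc n. qjac \<alpha> \<beta> q i j * (if i = m then 1 / ?h i else 0))"
      using that by (simp add: scalar_prod_def C_def E_def qjac_mat_def)
    also have "\<dots> = (\<Sum>i=0..<Suc n. if i = m then qjac \<alpha> \<beta> q i j / ?h i else 0)"
      by (intro sum.cong) auto
    finally have "(transpose_mat C * E) $$ (j, m) = \<dots>" .
    then show ?thesis using that by (simp del: index_mult_mat)
  qed
  show inv: "qmat_inv \<alpha> \<beta> q n = transpose_mat C * E * C"
  proof (rule eq_matI)
    fix j k assume "j < dim_row (transpose_mat C * E * C)" "k < dim_col (transpose_mat C * E * C)"
    then have jk: "j < Suc n" "k < Suc n"
      using C by auto
    have "(transpose_mat C * E * C) $$ (j, k) = (\<Sum>m=0..<Suc n. (transpose_mat C * E) $$ (j, m) * C $$ (m, k))"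
      using jk carrier_matD[OF C] carrier_matD[OF CE]
      by (subst index_mult_mat(1)) (simp_all add: scalar_prod_def del: index_mult_mat)
    also have "\<dots> = (\<Sum>m=0..<Suc n. qjac \<alpha> \<beta> q m j * qjac \<alpha> \<beta> q m k / ?h m)"
    proof (intro sum.cong refl)
      fix m assume m: "m \<in> {0..<Suc n}"
      have "C $$ (m, k) = qjac \<alpha> \<beta> q m k"
        using jk m by (simp add: C_def qjac_mat_def)
      then show "(transpose_mat C * E) $$ (j, m) * C $$ (m, k) = qjac \<alpha> \<beta> q m j * qjac \<alpha> \<beta> q m k / ?h m"
        using jk m CE_entry[of j m] by (simp del: index_mult_mat)
    qed
    finally show "qmat_inv \<alpha> \<beta> q n $$ (j, k) = (transpose_mat C * E * C) $$ (j, k)"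
      using jk by (simp add: qmat_inv_def qmat_inv_entry_eq[OF q A \<alpha> \<beta>] atLeastLessThanSuc_atLeastAtMost
        del: index_mult_mat)
  qed (use carrier_matD[OF C] in \<open>simp_all add: qmat_inv_def\<close>)
  have "C * (?M * (transpose_mat C * E)) = C * ?M * transpose_mat C * E"
    by (simp add: assoc_mult_mat[of _ "Suc n" "Suc n" _ "Suc n" _ "Suc n"] mult_carrier_mat[of _ _ "Suc n"])
  also have "\<dots> = 1\<^sub>m (Suc n)"
  proof (rule eq_matI)
    fix i j assume "i < dim_row (1\<^sub>m (Suc n) :: 'a mat)" "j < dim_col (1\<^sub>m (Suc n) :: 'a mat)"
    then have ij: "i < Suc n" "j < Suc n" by simp_all
    have "(C * ?M * transpose_mat C * E) $$ (i, j) =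
        (\<Sum>k=0..<Suc n. (if i = k then ?h i else 0) * (if k = j then 1 / ?h k else 0))"
      unfolding C_def qjac_gram[OF q(2) A] using ij by (simp add: scalar_prod_def E_def)
    also have "\<dots> = (\<Sum>k=0..<Suc n. if k = i then (if i = j then ?h i * (1 / ?h i) else 0) else 0)"
      by (intro sum.cong) auto
    also have "\<dots> = (1\<^sub>m (Suc n)) $$ (i, j)"
      using ij qjac_norm_nonzero[OF q A \<alpha> \<beta>, of i] by auto
    finally show "(C * ?M * transpose_mat C * E) $$ (i, j) = (1\<^sub>m (Suc n)) $$ (i, j)" .
  qed (simp_all add: C_def E_def qjac_mat_def)
  finally have "?M * (transpose_mat C * E) * C = 1\<^sub>m (Suc n)"
    by (rule mat_mult_left_right_inverse[rotated -1]) (auto intro: mult_carrier_mat[of _ _ "Suc n"])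
  then show 1: "?M * qmat_inv \<alpha> \<beta> q n = 1\<^sub>m (Suc n)"
    unfolding inv by (simp add: assoc_mult_mat[of _ "Suc n" "Suc n" _ "Suc n" _ "Suc n"])
  show "qmat_inv \<alpha> \<beta> q n * ?M = 1\<^sub>m (Suc n)"
    by (rule mat_mult_left_right_inverse[OF _ _ 1]) simp_all
qed

section \<open>Positive definiteness and the smallest eigenvalue\<close>

text \<open>A complex eigenvalue l with eigenvector z exists. The form T of the matrix at z is real
  by symmetry and equals l times the positive number S, so l is real.\<close>

lemma symmetric_real_mat_has_eigenvalue:
  fixes A :: "real mat"
  assumes A: "A \<in> carrier_mat n n" and sym: "transpose_mat A = A" and n: "n > 0"
  shows "\<exists>\<mu>. eigenvalue A \<mu>"
proof -
  let ?A = "map_mat complex_of_real A"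
  have cA: "?A \<in> carrier_mat n n" using A by simp
  obtain l where ev: "eigenvalue ?A l"
    using spectrum_non_empty[OF cA n] by (auto simp: spectrum_def)
  then obtain z where z: "z \<in> carrier_vec n" "z \<noteq> 0\<^sub>v n" "?A *\<^sub>v z = l \<cdot>\<^sub>v z"
    using A by (auto simp: eigenvalue_def eigenvector_def)
  define S where "S = (\<Sum>i<n. (cmod (z $ i))\<^sup>2)"
  define T where "T = (\<Sum>i<n. \<Sum>j<n. cnj (z $ i) * (of_real (A $$ (i, j)) * z $ j))"
  have "S > 0"
  proof -
    obtain i where "i < n" "z $ i \<noteq> 0" using z(1,2) by force
    then show ?thesis
      unfolding S_def by (intro sum_pos2[of _ i]) auto
  qed
  have row_eq: "(\<Sum>j<n. of_real (A $$ (i, j)) * z $ j) = l * z $ i" if "i < n" for i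
    using arg_cong[OF z(3), of "\<lambda>v. v $ i"] that A z(1)
    by (simp add: scalar_prod_def row_def lessThan_atLeast0)
  have "T = (\<Sum>i<n. cnj (z $ i) * (l * z $ i))"
    unfolding T_def sum_distrib_left[symmetric] using row_eq by simp
  also have "\<dots> = l * of_real S"
    unfolding S_def of_real_sum sum_distrib_left complex_norm_square
    by (intro sum.cong refl) (simp add: mult_ac)
  finally have T1: "T = l * of_real S" .
  have A_sym: "A $$ (i, j) = A $$ (j, i)" if "i < n" "j < n" for i j
    using arg_cong[OF sym, of "\<lambda>X. X $$ (j, i)"] that A by simp
  have "cnj T = (\<Sum>i<n. \<Sum>j<n. cnj (z $ j) * (of_real (A $$ (i, j)) * z $ i))"
    unfolding T_def by (simp add: mult_ac)
  also have "\<dots> = T"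
    unfolding T_def by (subst sum.swap) (auto intro!: sum.cong simp: A_sym)
  finally have "cnj l = l" using T1 \<open>S > 0\<close> by simp
  then obtain r where r: "l = of_real r"
    by (metis Reals_cases complex_cnj_cancel_iff Reals_cnj_iff)
  \<comment> \<open>The complex characteristic polynomial is the image of the real one, so the real
    root descends.\<close>
  have "poly (map_poly complex_of_real (char_poly A)) (of_real r) = 0"
    using ev unfolding eigenvalue_root_char_poly[OF cA] of_real_hom.char_poly_hom[OF A] r .
  then have "poly (char_poly A) r = 0"
    by simp
  then show ?thesis using eigenvalue_root_char_poly[OF A] by blast
qed

lemma symmetric_real_mat_smallest_eigenvalue:
  fixes A :: "real mat"
  assumes A: "A \<in> carrier_mat n n" and "transpose_mat A = A" and "n > 0"
  obtains \<mu> where "is_smallest_eigenvalue A \<mu>"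
proof -
  have "finite (spectrum A)" "spectrum A \<noteq> {}"
    using card_finite_spectrum[OF A] symmetric_real_mat_has_eigenvalue[OF assms]
    by (auto simp: spectrum_def)
  then have "is_smallest_eigenvalue A (Min (spectrum A))"
    using Min_in[of "spectrum A"] by (auto simp: is_smallest_eigenvalue_def spectrum_def)
  then show thesis by (rule that)
qed

text \<open>The inverse is C^T D^(-1) C; moving C^T across the scalar product diagonalizes the
  form.\<close>

lemma qmat_inv_quadratic_form:
  fixes q :: "'a::real_normed_field"
  assumes q: "q \<noteq> 0" "\<And>m. qpoch q q m \<noteq> 0" and A: "qpoch (\<alpha> * \<beta>) q (2 * n) \<noteq> 0"
    and \<alpha>: "\<alpha> \<noteq> 0" "qpoch \<alpha> q n \<noteq> 0" and \<beta>: "qpoch \<beta> q n \<noteq> 0"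
    and u: "u \<in> carrier_vec (Suc n)"
  shows "u \<bullet> (qmat_inv \<alpha> \<beta> q n *\<^sub>v u) =
    (\<Sum>m=0..n. ((qjac_mat \<alpha> \<beta> q n *\<^sub>v u) $ m)\<^sup>2 / qjac_norm \<alpha> \<beta> q m)"
proof -
  define C where "C = qjac_mat \<alpha> \<beta> q n"
  define E where "E = Matrix.mat (Suc n) (Suc n) (\<lambda>(i, j). if i = j then 1 / qjac_norm \<alpha> \<beta> q i else 0)"
  have C: "C \<in> carrier_mat (Suc n) (Suc n)" "transpose_mat C \<in> carrier_mat (Suc n) (Suc n)"
    and E: "E \<in> carrier_mat (Suc n) (Suc n)"
    by (simp_all add: C_def E_def)
  define w where "w = C *\<^sub>v u"
  have w: "w \<in> carrier_vec (Suc n)" using C u by (simp add: w_def)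
  have Ew: "E *\<^sub>v w \<in> carrier_vec (Suc n)" using E w by simp
  have "qmat_inv \<alpha> \<beta> q n *\<^sub>v u = transpose_mat C *\<^sub>v (E *\<^sub>v w)"
    unfolding qmat_inv_eq(1)[OF q A \<alpha> \<beta>] C_def[symmetric] E_def[symmetric] w_def
    using assoc_mult_mat_vec[OF mult_carrier_mat[OF C(2) E] C(1) u]
      assoc_mult_mat_vec[OF C(2) E w] by (simp only: w_def)
  then have "u \<bullet> (qmat_inv \<alpha> \<beta> q n *\<^sub>v u) = (transpose_mat C *\<^sub>v (E *\<^sub>v w)) \<bullet> u"
    using u C Ew by (simp add: comm_scalar_prod[of u "Suc n"])
  also have "\<dots> = (E *\<^sub>v w) \<bullet> w"
    unfolding w_def by (rule transpose_vec_mult_scalar[OF C(1) u]) (use Ew in \<open>simp add: w_def\<close>)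
  also have "\<dots> = (\<Sum>m=0..n. (w $ m)\<^sup>2 / qjac_norm \<alpha> \<beta> q m)"
  proof -
    have "(E *\<^sub>v w) $ m = w $ m / qjac_norm \<alpha> \<beta> q m" if "m < Suc n" for m
    proof -
      have "(E *\<^sub>v w) $ m = (\<Sum>k=0..<Suc n. (if m = k then 1 / qjac_norm \<alpha> \<beta> q m else 0) * w $ k)"
        using that w by (simp add: E_def scalar_prod_def)
      also have "\<dots> = (\<Sum>k=0..<Suc n. if m = k then w $ k / qjac_norm \<alpha> \<beta> q m else 0)"
        by (intro sum.cong) auto
      finally show ?thesis using that by simp
    qed
    then show ?thesis
      using w by (simp add: scalar_prod_def power2_eq_square atLeastLessThanSuc_atLeastAtMost)
  qed
  finally show ?thesis by (simp only: w_def C_def)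
qed

section \<open>Signs for real parameters and the terminating hypergeometric series\<close>

lemma qpoch_pos:
  fixes a q :: real
  assumes "0 < q" "q < 1" "a < 1"
  shows "0 < qpoch a q m"
  unfolding qpoch_def
proof (rule prod_pos)
  fix i
  have "a * q ^ i < 1"
  proof (cases "a \<le> 0")
    case True
    then have "a * q ^ i \<le> 0" using assms by (intro mult_nonpos_nonneg) simp_all
    then show ?thesis by simp
  next
    case False
    then have "a * q ^ i \<le> a" using assms by (simp add: mult_left_le power_le_one)
    then show ?thesis using assms by simp
  qed
  then show "0 < 1 - a * q ^ i" by simp
qed

lemma qbinom_nonneg:
  fixes q :: real
  assumes "0 < q" "q < 1"
  shows "0 \<le> qbinom m k q"
  using qpoch_pos[OF assms assms(2)] by (simp add: qbinom_def less_imp_le)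

text \<open>Denominator-free form of the identity turning (q^(-l);q)_k into a Gaussian binomial. The
  new factor times q^l is -q^k (1 - q^(l-k)), and 1 - q^(l-k) is what (q;q)_(l-k) loses.\<close>

lemma qpoch_neg_power:
  fixes q :: "'a::real_normed_field"
  assumes "q \<noteq> 0" "k \<le> l"
  shows "qpoch (q powi (- int l)) q k * q ^ (k * l) * qpoch q q (l - k) =
    (-1) ^ k * q ^ (k choose 2) * qpoch q q l"
  using assms(2)
proof (induction k)
  case (Suc k)
  let ?Q = "q powi (- int l)"
  have "l - k = Suc (l - Suc k)" using Suc.prems by simp
  then have 1: "qpoch q q (l - k) = qpoch q q (l - Suc k) * (1 - q ^ (l - k))"
    by (simp add: qpoch_Suc)
  have "?Q * q ^ l = 1" using assms(1) by (simp add: power_int_minus)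
  moreover have "(1 - ?Q * q ^ k) * q ^ l = q ^ l - ?Q * q ^ l * q ^ k"
    by (simp add: algebra_simps)
  ultimately have "(1 - ?Q * q ^ k) * q ^ l = q ^ l - q ^ k"
    by (simp only: mult_1_left)
  also have "\<dots> = - (q ^ k * (1 - q ^ (l - k)))"
    using Suc.prems by (simp add: right_diff_distrib flip: power_add)
  finally have 2: "(1 - ?Q * q ^ k) * q ^ l = - (q ^ k * (1 - q ^ (l - k)))" .
  have "qpoch ?Q q (Suc k) * q ^ (Suc k * l) * qpoch q q (l - Suc k) =
      qpoch ?Q q k * q ^ (k * l) * qpoch q q (l - Suc k) * ((1 - ?Q * q ^ k) * q ^ l)"
    by (simp add: qpoch_Suc power_add mult_ac)
  also have "\<dots> = - (q ^ k) * (qpoch ?Q q k * q ^ (k * l) * qpoch q q (l - k))"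
    unfolding 2 1 by (simp add: mult_ac)
  also have "qpoch ?Q q k * q ^ (k * l) * qpoch q q (l - k) = (-1) ^ k * q ^ (k choose 2) * qpoch q q l"
    using Suc by simp
  finally show ?case by (simp add: choose_two_Suc power_add mult_ac)
qed simp

context
  fixes \<alpha> \<beta> q :: real
  assumes q: "0 < q" "q < 1" and \<alpha>: "0 < \<alpha>" "\<alpha> < 1" and \<beta>: "0 < \<beta>" "\<beta> < 1"
begin

lemma product_less_one: "\<alpha> * \<beta> * q ^ i < 1"
proof -
  have "\<beta> * q ^ i \<le> 1"
    using q \<beta> by (intro mult_le_one power_le_one) auto
  then have "\<alpha> * (\<beta> * q ^ i) \<le> \<alpha>"
    using \<alpha> by (simp add: mult_left_le)
  then show ?thesis using \<alpha>(2) unfolding mult.assoc by linarith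
qed

lemma qpoch_all_pos:
  "0 < qpoch q q m" "0 < qpoch \<alpha> q m" "0 < qpoch \<beta> q m" "0 < qpoch (\<alpha> * \<beta>) q m"
  "0 < qpoch (\<alpha> * \<beta> * q ^ i) q m"
  using qpoch_pos[OF q] q \<alpha> \<beta> product_less_one product_less_one[of 0] by simp_all

lemma qpoch_all_nonzero:
  "q \<noteq> 0" "qpoch q q m \<noteq> 0" "qpoch (\<alpha> * \<beta>) q m \<noteq> 0" "\<alpha> \<noteq> 0" "qpoch \<alpha> q m \<noteq> 0" "qpoch \<beta> q m \<noteq> 0"
  using q \<alpha> qpoch_all_pos[of m] by auto

text \<open>The premises of the inversion lemmas, in their order.\<close>

lemmas qmat_facts = qpoch_all_nonzero(1,2) qpoch_all_nonzero(3)[of "2 * _"]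
  qpoch_all_nonzero(4) qpoch_all_nonzero(5,6)

lemma qjac_norm_pos: "0 < qjac_norm \<alpha> \<beta> q m"
  unfolding qjac_norm_def using q \<alpha> by (intro divide_pos_pos mult_pos_pos qpoch_all_pos zero_less_power)

text \<open>With u = M v, the form of M at v is the form of the inverse at u, a sum of squares over
  positive norms.\<close>

lemma pos_def_qmat: "pos_def_mat (qmat \<alpha> \<beta> q n)"
  unfolding pos_def_mat_def
proof (intro conjI ballI impI)
  show "square_mat (qmat \<alpha> \<beta> q n)" by (simp add: qmat_def)
  show "transpose_mat (qmat \<alpha> \<beta> q n) = qmat \<alpha> \<beta> q n" by (rule transpose_qmat)
  fix v :: "real vec" assume "v \<in> carrier_vec (dim_row (qmat \<alpha> \<beta> q n))" "v \<noteq> 0\<^sub>v (dim_row (qmat \<alpha> \<beta> q n))"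
  then have v: "v \<in> carrier_vec (Suc n)" "v \<noteq> 0\<^sub>v (Suc n)" by (simp_all add: qmat_def)
  let ?C = "qjac_mat \<alpha> \<beta> q n" and ?M = "qmat \<alpha> \<beta> q n" and ?I = "qmat_inv \<alpha> \<beta> q n"
  define u where "u = ?M *\<^sub>v v"
  have u: "u \<in> carrier_vec (Suc n)" unfolding u_def by (rule mult_mat_vec_carrier[OF qmat_carrier v(1)])
  have vu: "v = ?I *\<^sub>v u"
    using v qmat_inv_eq(3)[OF qmat_facts, of n]
    by (simp add: u_def flip: assoc_mult_mat_vec[of _ "Suc n" "Suc n" _ "Suc n"])
  have "v \<bullet> (?M *\<^sub>v v) = u \<bullet> (?I *\<^sub>v u)"
    unfolding vu[symmetric] u_def[symmetric] by (rule comm_scalar_prod[OF v(1) u])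
  also have "\<dots> = (\<Sum>m=0..n. ((?C *\<^sub>v u) $ m)\<^sup>2 / qjac_norm \<alpha> \<beta> q m)"
    by (rule qmat_inv_quadratic_form[OF qmat_facts u])
  also have "\<dots> > 0"
  proof (rule ccontr)
    assume "\<not> ?thesis"
    moreover have nn: "0 \<le> ((?C *\<^sub>v u) $ m)\<^sup>2 / qjac_norm \<alpha> \<beta> q m" for m
      using qjac_norm_pos[of m] by simp
    moreover have "0 \<le> (\<Sum>m=0..n. ((?C *\<^sub>v u) $ m)\<^sup>2 / qjac_norm \<alpha> \<beta> q m)"
      by (rule sum_nonneg) (rule nn)
    ultimately have "(\<Sum>m=0..n. ((?C *\<^sub>v u) $ m)\<^sup>2 / qjac_norm \<alpha> \<beta> q m) = 0"
      by linarith
    then have "(?C *\<^sub>v u) $ m = 0" if "m \<le> n" for m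
      using that nn qjac_norm_pos[of m] by (subst (asm) sum_nonneg_eq_0_iff) auto
    then have "?C *\<^sub>v u = 0\<^sub>v (Suc n)"
      by (intro eq_vecI) (simp_all add: qjac_mat_def del: index_mult_mat_vec)
    \<comment> \<open>The inverse ends in the factor C, so C u = 0 already forces v = 0.\<close>
    moreover obtain X where "X \<in> carrier_mat (Suc n) (Suc n)" "?I = X * ?C"
    proof
      show "?I = transpose_mat ?C * Matrix.mat (Suc n) (Suc n)
          (\<lambda>(i, j). if i = j then 1 / qjac_norm \<alpha> \<beta> q i else 0) * ?C"
        by (rule qmat_inv_eq(1)[OF qmat_facts])
    qed (rule mult_carrier_mat[of _ _ "Suc n"], simp_all)
    ultimately have "v = 0\<^sub>v (Suc n)"
      unfolding vu using assoc_mult_mat_vec[OF _ qjac_mat_carrier u] by auto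
    then show False using v by simp
  qed
  finally show "0 < v \<bullet> (?M *\<^sub>v v)" .
qed

text \<open>For an eigenvector v, v \<bullet> v equals \<mu> times the form of the inverse at v, and
  that form is at most S (v \<bullet> v). Dividing gives 1 \<le> \<mu> S.\<close>

lemma eigenvalue_qmat_ge:
  assumes "eigenvalue (qmat \<alpha> \<beta> q n) \<mu>"
  shows "inverse (\<Sum>m=0..n. (\<Sum>k\<le>m. \<bar>qjac \<alpha> \<beta> q m k\<bar>)\<^sup>2 / qjac_norm \<alpha> \<beta> q m) \<le> \<mu>"
proof -
  let ?C = "qjac_mat \<alpha> \<beta> q n" and ?M = "qmat \<alpha> \<beta> q n" and ?I = "qmat_inv \<alpha> \<beta> q n"
  define S where "S = (\<Sum>m=0..n. (\<Sum>k\<le>m. \<bar>qjac \<alpha> \<beta> q m k\<bar>)\<^sup>2 / qjac_norm \<alpha> \<beta> q m)"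
  obtain v where v: "v \<in> carrier_vec (Suc n)" "v \<noteq> 0\<^sub>v (Suc n)" "?M *\<^sub>v v = \<mu> \<cdot>\<^sub>v v"
    using assms by (auto simp: eigenvalue_def eigenvector_def qmat_def)
  define N where "N = v \<bullet> v"
  have N: "N = (\<Sum>k\<le>n. (v $ k)\<^sup>2)"
    using v(1) by (simp add: N_def scalar_prod_def power2_eq_square atLeast0LessThan lessThan_Suc_atMost)
  have "0 < N"
    using conjugate_square_greater_0_vec[OF v(1)] v(2) by (simp add: N_def)
  have "v = ?I *\<^sub>v (?M *\<^sub>v v)"
    using v(1) qmat_inv_eq(3)[OF qmat_facts, of n]
    by (simp flip: assoc_mult_mat_vec[of _ "Suc n" "Suc n" _ "Suc n"])
  also have "\<dots> = \<mu> \<cdot>\<^sub>v (?I *\<^sub>v v)"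
    unfolding v(3) by (rule mult_mat_vec[OF qmat_inv_carrier v(1)])
  finally have "N = v \<bullet> (\<mu> \<cdot>\<^sub>v (?I *\<^sub>v v))"
    by (simp add: N_def)
  also have "\<dots> = \<mu> * (v \<bullet> (?I *\<^sub>v v))"
    by (rule scalar_prod_smult_distrib[of _ "Suc n"]) (rule v(1) mult_mat_vec_carrier[OF qmat_inv_carrier])+
  also have "v \<bullet> (?I *\<^sub>v v) = (\<Sum>m=0..n. ((?C *\<^sub>v v) $ m)\<^sup>2 / qjac_norm \<alpha> \<beta> q m)"
    by (rule qmat_inv_quadratic_form[OF qmat_facts v(1)])
  finally have eq: "N = \<mu> * (\<Sum>m=0..n. ((?C *\<^sub>v v) $ m)\<^sup>2 / qjac_norm \<alpha> \<beta> q m)" (is "_ = _ * ?F") .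
  have "0 \<le> ?F"
    using qjac_norm_pos by (intro sum_nonneg) (simp add: less_imp_le)
  then have "0 < \<mu>"
    using \<open>0 < N\<close> unfolding eq zero_less_mult_iff by linarith
  have "?F \<le> (\<Sum>m=0..n. (\<Sum>k\<le>m. \<bar>qjac \<alpha> \<beta> q m k\<bar>)\<^sup>2 / qjac_norm \<alpha> \<beta> q m * N)"
  proof (rule sum_mono)
    fix m assume m: "m \<in> {0..n}"
    have "(?C *\<^sub>v v) $ m = (\<Sum>k=0..<Suc n. qjac \<alpha> \<beta> q m k * v $ k)"
      using m v(1) by (simp add: qjac_mat_def scalar_prod_def)
    also have "\<dots> = (\<Sum>k\<le>m. qjac \<alpha> \<beta> q m k * v $ k)"
      using m by (intro sum.mono_neutral_right) (auto simp: qjac_eq_0)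
    \<comment> \<open>Each coordinate is bounded by the Euclidean norm; this crude estimate is what
      produces absolute coefficient sums, hence values at -1.\<close>
    also have "\<bar>\<dots>\<bar> \<le> (\<Sum>k\<le>m. \<bar>qjac \<alpha> \<beta> q m k\<bar> * sqrt N)"
    proof (rule order.trans[OF sum_abs sum_mono])
      fix k assume "k \<in> {..m}"
      then have "(v $ k)\<^sup>2 \<le> N"
        unfolding N using m by (intro member_le_sum) auto
      then have "\<bar>v $ k\<bar> \<le> sqrt N" by (simp add: real_le_rsqrt)
      then show "\<bar>qjac \<alpha> \<beta> q m k * v $ k\<bar> \<le> \<bar>qjac \<alpha> \<beta> q m k\<bar> * sqrt N"
        by (simp add: abs_mult mult_left_mono)
    qed
    finally have "\<bar>(?C *\<^sub>v v) $ m\<bar> \<le> (\<Sum>k\<le>m. \<bar>qjac \<alpha> \<beta> q m k\<bar>) * sqrt N"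
      by (simp add: sum_distrib_right)
    then have "\<bar>(?C *\<^sub>v v) $ m\<bar>\<^sup>2 \<le> ((\<Sum>k\<le>m. \<bar>qjac \<alpha> \<beta> q m k\<bar>) * sqrt N)\<^sup>2"
      by (rule power_mono) simp
    then have "((?C *\<^sub>v v) $ m)\<^sup>2 \<le> (\<Sum>k\<le>m. \<bar>qjac \<alpha> \<beta> q m k\<bar>)\<^sup>2 * N"
      using \<open>0 < N\<close> by (simp add: power_mult_distrib)
    then show "((?C *\<^sub>v v) $ m)\<^sup>2 / qjac_norm \<alpha> \<beta> q m \<le>
        (\<Sum>k\<le>m. \<bar>qjac \<alpha> \<beta> q m k\<bar>)\<^sup>2 / qjac_norm \<alpha> \<beta> q m * N"
      unfolding times_divide_eq_left by (rule divide_right_mono) (rule less_imp_le[OF qjac_norm_pos])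
  qed
  then have "?F \<le> S * N" by (simp add: S_def sum_distrib_right)
  then have "\<mu> * ?F \<le> \<mu> * (S * N)"
    using \<open>0 < \<mu>\<close> by (intro mult_left_mono) simp_all
  then have "1 * N \<le> \<mu> * S * N" by (simp only: mult_1_left mult.assoc flip: eq)
  then have "1 \<le> \<mu> * S" using \<open>0 < N\<close> by (simp only: mult_le_cancel_right_pos)
  moreover from this have "0 < S"
    using \<open>0 < \<mu>\<close> zero_less_mult_iff[of \<mu> S] by linarith
  ultimately show ?thesis
    unfolding S_def[symmetric] by (simp add: field_simps)
qed

text \<open>The sign (-1)^k of (q^(-l);q)_k cancels the one from the argument -1, so every term is
  nonnegative. The factor on the left is the scaling built into \<open>qjac\<close>.\<close>

lemma lqj_poly_minus_one:
  "lqj_poly l (-1) \<alpha> \<beta> q * (q ^ (l choose 2) * qpoch \<alpha> q l) = (\<Sum>k\<le>l. \<bar>qjac \<alpha> \<beta> q l k\<bar>)"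
proof -
  let ?Q = "q powi (- int l)" and ?B = "\<alpha> * \<beta> * q powi (int l - 1)" and ?b = "\<alpha> * \<beta> * q ^ (l - 1)"
  let ?t = "\<lambda>k. (qpoch ?Q q k * qpoch ?B q k) / (qpoch q q k * qpoch \<alpha> q k) * (q * (-1)) ^ k"
  \<comment> \<open>Beyond k = l the product contains 1 - q^(-l) q^l = 0, so the series
    terminates.\<close>
  have Q0: "qpoch ?Q q k = 0" if "k \<notin> {..l}" for k
    unfolding qpoch_def
  proof (rule prod_zero)
    have "1 - ?Q * q ^ l = 0" using q by (simp add: power_int_minus)
    then show "\<exists>i\<in>{..<k}. 1 - ?Q * q ^ i = 0" using that by (intro bexI[of _ l]) auto
  qed simp
  have "lqj_poly l (-1) \<alpha> \<beta> q = (\<Sum>k\<le>l. ?t k)"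
    unfolding lqj_poly_def qhyp21_def by (rule suminf_finite) (simp_all add: Q0)
  also have "\<dots> * (q ^ (l choose 2) * qpoch \<alpha> q l) = (\<Sum>k\<le>l. \<bar>qjac \<alpha> \<beta> q l k\<bar>)"
    unfolding sum_distrib_right
  proof (intro sum.cong refl)
    fix k assume k: "k \<in> {..l}"
    have B: "qpoch ?B q k = qpoch ?b q k"
      using k by (cases l) simp_all
    have "qpoch ?Q q k * (q ^ (k * l) * qpoch q q (l - k)) = (-1) ^ k * q ^ (k choose 2) * qpoch q q l"
      using qpoch_neg_power[of q k l] q k by (simp add: mult.assoc)
    then have "qpoch ?Q q k = (-1) ^ k * q ^ (k choose 2) * qpoch q q l / (q ^ (k * l) * qpoch q q (l - k))"
      using q qpoch_all_nonzero(2) by (simp add: eq_divide_eq)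
    then have "qpoch ?Q q k / qpoch q q k = (-1) ^ k * q ^ (k choose 2) * qbinom l k q / q ^ (k * l)"
      using k by (simp add: qbinom_def mult_ac)
    then have "?t k = ((-1) ^ k * (-1) ^ k) * (q ^ (Suc k choose 2) * qbinom l k q * qpoch ?b q k /
        (q ^ (k * l) * qpoch \<alpha> q k))"
      unfolding B times_divide_times_eq[symmetric] power_mult_distrib[of q]
      by (simp add: choose_two_Suc power_add mult_ac)
    also have "(-1) ^ k * (-1) ^ k = (1 :: real)"
      by (simp flip: power_mult_distrib)
    finally have t: "?t k = q ^ (Suc k choose 2) * qbinom l k q * qpoch ?b q k / (q ^ (k * l) * qpoch \<alpha> q k)"
      by simp
    have t_nonneg: "0 \<le> ?t k * (q ^ (l choose 2) * qpoch \<alpha> q l)"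
      unfolding t using qpoch_all_pos[THEN less_imp_le] qbinom_nonneg[OF q] q
      by (intro divide_nonneg_nonneg mult_nonneg_nonneg) auto
    have "qjac \<alpha> \<beta> q l k = (-1) ^ k * (?t k * (q ^ (l choose 2) * qpoch \<alpha> q l))"
      unfolding t using k by (subst qjac_eq[OF qpoch_all_nonzero(1,5)]) (simp_all add: mult_ac)
    then show "?t k * (q ^ (l choose 2) * qpoch \<alpha> q l) = \<bar>qjac \<alpha> \<beta> q l k\<bar>"
      using t_nonneg by (simp only: abs_mult[of "(-1) ^ k"] power_abs abs_minus_cancel abs_one
        power_one mult_1_left abs_of_nonneg)
  qed
  finally show ?thesis .
qed

text \<open>\<open>qjac\<close> describes polynomials scaled by q^(l choose 2) (\<alpha>;q)_l, so
  squared norms scale by its square. The quotient of infinite products is the total mass, which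
  \<open>qmat\<close> normalizes to 1.\<close>

lemma lqj_norm_eq:
  "lqj_norm l \<alpha> \<beta> q = qpoch_inf (\<alpha> * \<beta>) q / qpoch_inf \<alpha> q *
    (qjac_norm \<alpha> \<beta> q l / (q ^ (l choose 2) * qpoch \<alpha> q l)\<^sup>2)"
proof (cases l)
  case 0
  then show ?thesis using q by (simp add: lqj_norm_cancelled qjac_norm_def)
next
  case (Suc r)
  let ?A = "\<alpha> * \<beta>"
  have p: "q powi (2 * int l - 1) = q ^ (r + l)"
  proof -
    have "2 * int l - 1 = int (r + l)" by (simp add: Suc)
    then show ?thesis by (simp only: power_int_of_nat)
  qed
  have "qpoch ?A q (2 * l) = qpoch ?A q (r + Suc l)"
    by (simp add: Suc mult_2)
  also have "\<dots> = qpoch ?A q r * (qpoch (?A * q ^ r) q l * (1 - ?A * q ^ (r + l)))"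
    by (simp add: qpoch_add qpoch_Suc power_add mult_ac)
  finally have A: "qpoch ?A q (2 * l) = qpoch ?A q r * (qpoch (?A * q ^ r) q l * (1 - ?A * q ^ (r + l)))" .
  have r: "l - 1 = r" by (simp add: Suc)
  have l0: "l \<noteq> 0" by (simp add: Suc)
  have nz: "1 - ?A * q ^ (r + l) \<noteq> 0" "qpoch (?A * q ^ r) q l \<noteq> 0"
    using product_less_one[of "r + l"] qpoch_all_pos(5)[of r l] by auto
  have "qpoch q q l * qpoch \<beta> q l * \<alpha> ^ l / ((1 - ?A * q ^ (r + l)) * (qpoch \<alpha> q l * qpoch ?A q r)) =
      qjac_norm \<alpha> \<beta> q l / (q ^ (l choose 2) * qpoch \<alpha> q l)\<^sup>2"
  proof -
    \<comment> \<open>Naming the factors by variables reduces the comparison to plain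
      cancellation.\<close>
    have "a * b * c / (d * (e * f)) = c * (g * g) * (a * e * b) * h / (f * (h * d)) / (g * e)\<^sup>2"
      if "d \<noteq> 0" "e \<noteq> 0" "f \<noteq> 0" "g \<noteq> 0" "h \<noteq> 0" for a b c d e f g h :: real
      using that by (simp add: power2_eq_square mult_ac)
    note cancel = this
    show ?thesis
      unfolding qjac_norm_def power_times_pred
      unfolding A r by (rule cancel) (use nz qpoch_all_nonzero in simp_all)
  qed
  then show ?thesis
    using q l0 unfolding lqj_norm_cancelled[OF qpoch_all_nonzero(1)] p r by simp
qed

text \<open>The scaling cancels between squared value and norm; only the mass remains.\<close>

lemma lqj_sum_eq:
  "(\<Sum>l=0..n. (lqj_poly l (-1) \<alpha> \<beta> q) ^ 2 / lqj_norm l \<alpha> \<beta> q) =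
    qpoch_inf \<alpha> q / qpoch_inf (\<alpha> * \<beta>) q *
    (\<Sum>m=0..n. (\<Sum>k\<le>m. \<bar>qjac \<alpha> \<beta> q m k\<bar>)\<^sup>2 / qjac_norm \<alpha> \<beta> q m)"
  unfolding sum_distrib_left
proof (intro sum.cong refl)
  fix l
  have "q ^ (l choose 2) * qpoch \<alpha> q l \<noteq> 0"
    using qpoch_all_nonzero by simp
  then show "(lqj_poly l (-1) \<alpha> \<beta> q) ^ 2 / lqj_norm l \<alpha> \<beta> q =
    qpoch_inf \<alpha> q / qpoch_inf (\<alpha> * \<beta>) q * ((\<Sum>k\<le>l. \<bar>qjac \<alpha> \<beta> q l k\<bar>)\<^sup>2 / qjac_norm \<alpha> \<beta> q l)"
    unfolding lqj_norm_eq lqj_poly_minus_one[symmetric] by (simp add: power_mult_distrib)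
qed

lemma smallest_eigenvalue_qmat:
  "\<exists>\<mu>. is_smallest_eigenvalue (qmat \<alpha> \<beta> q n) \<mu> \<and>
    \<mu> \<ge> qpoch_inf \<alpha> q / qpoch_inf (\<alpha> * \<beta>) q *
      inverse (\<Sum>l=0..n. (lqj_poly l (-1) \<alpha> \<beta> q) ^ 2 / lqj_norm l \<alpha> \<beta> q)"
proof -
  obtain \<mu> where \<mu>: "is_smallest_eigenvalue (qmat \<alpha> \<beta> q n) \<mu>"
    by (rule symmetric_real_mat_smallest_eigenvalue[OF qmat_carrier transpose_qmat]) auto
  let ?S = "\<Sum>m=0..n. (\<Sum>k\<le>m. \<bar>qjac \<alpha> \<beta> q m k\<bar>)\<^sup>2 / qjac_norm \<alpha> \<beta> q m"
  have "inverse ?S \<le> \<mu>"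
    using \<mu> by (intro eigenvalue_qmat_ge) (simp add: is_smallest_eigenvalue_def)
  moreover have "0 \<le> inverse ?S"
    using qjac_norm_pos by (simp add: sum_nonneg less_imp_le)
  \<comment> \<open>K will be the quotient of infinite products. If it were 0, the bound would be 0
    and hold by nonnegativity, so no statement about convergence or nonvanishing is
    required.\<close>
  moreover have "K * inverse (K * x) = (if K = 0 then 0 else inverse x)" for K x :: real
    by simp
  ultimately have "K * inverse (K * ?S) \<le> \<mu>" for K
    by (simp only: split: if_split) (meson order.trans)
  then show ?thesis
    using \<mu> unfolding lqj_sum_eq by blast
qed

end

section \<open>Translation of the parameter conditions and assembly of the three claims\<close>

lemma qpoch_nonzero_powi:
  fixes q :: "'a::real_normed_field"
  assumes "q \<noteq> 0" "\<And>k. k < m \<Longrightarrow> a \<noteq> q powi (- int k)"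
  shows "qpoch a q m \<noteq> 0"
proof -
  have "1 - a * q ^ k \<noteq> 0" if "k < m" for k
    using assms(2)[OF that] assms(1) by (auto simp: power_int_minus field_simps)
  then show ?thesis by (simp add: qpoch_def)
qed

lemma qpoch_self_nonzero:
  fixes q :: real
  assumes "0 < q" "q < 1"
  shows "qpoch (of_real q) (of_real q) m \<noteq> (0 :: complex)"
proof -
  have "qpoch (of_real q) (of_real q) m = (of_real (qpoch q q m) :: complex)"
    by (simp add: qpoch_def)
  then show ?thesis using qpoch_pos[OF assms assms(2), of m] by simp
qed

text \<open>The condition on \<alpha>\<beta> in the first two claims amounts to
  (\<alpha>\<beta>;q)_(2n) being nonzero, so that all entries are genuine quotients.\<close>

theorem theorem7:
  fixes n :: nat and q :: real
  assumes "0 < q" and "q < 1"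
  shows
    "(\<forall>\<alpha> \<beta> Q :: complex.
        Q = of_real q \<and> (\<forall>k<2 * n. \<alpha> * \<beta> \<noteq> Q powi (- int k)) \<longrightarrow>
        Determinant.det (qmat \<alpha> \<beta> Q n) =
          \<alpha> ^ (n * (n + 1) div 2) * Q ^ (n * (n ^ 2 - 1) div 3) *
          (\<Prod>m=1..n. qpoch Q Q m * qpoch \<alpha> Q m * qpoch \<beta> Q m) /
          (\<Prod>m=1..n. qpoch (\<alpha> * \<beta> * Q powi (int m - 1)) Q m * qpoch (\<alpha> * \<beta>) Q (2 * m)))
     \<and>
     (\<forall>\<alpha> \<beta> Q :: complex.
        Q = of_real q \<and> (\<forall>k<2 * n. \<alpha> * \<beta> \<noteq> Q powi (- int k)) \<and>
        \<alpha> \<noteq> 0 \<and> Q \<noteq> 0 \<and>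
        (\<forall>k\<le>n. Q \<noteq> Q powi (- int k) \<and> \<alpha> \<noteq> Q powi (- int k) \<and> \<beta> \<noteq> Q powi (- int k)) \<longrightarrow>
        invertible_mat (qmat \<alpha> \<beta> Q n) \<and>
        (let \<Gamma> = Matrix.mat (n + 1) (n + 1) (\<lambda>(j, k). qmat_inv_entry \<alpha> \<beta> Q n j k)
         in inverts_mat (qmat \<alpha> \<beta> Q n) \<Gamma> \<and> inverts_mat \<Gamma> (qmat \<alpha> \<beta> Q n)))
     \<and>
     (\<forall>\<alpha> \<beta> :: real.
        0 < \<alpha> \<and> \<alpha> < 1 \<and> 0 < \<beta> \<and> \<beta> < 1 \<longrightarrow>
        pos_def_mat (qmat \<alpha> \<beta> q n) \<and>
        (\<exists>\<mu>. is_smallest_eigenvalue (qmat \<alpha> \<beta> q n) \<mu> \<and>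
          \<mu> \<ge> qpoch_inf \<alpha> q / qpoch_inf (\<alpha> * \<beta>) q *
            inverse (\<Sum>l=0..n. (lqj_poly l (-1) \<alpha> \<beta> q) ^ 2 / lqj_norm l \<alpha> \<beta> q)))"
proof (intro conjI allI impI; (elim conjE)?)
  fix \<alpha> \<beta> Q :: complex
  assume Q: "Q = of_real q" and A: "\<forall>k<2 * n. \<alpha> * \<beta> \<noteq> Q powi (- int k)"
  have Q0: "Q \<noteq> 0" "\<And>m. qpoch Q Q m \<noteq> 0"
    using assms qpoch_self_nonzero[OF assms] by (simp_all add: Q)
  have A0: "qpoch (\<alpha> * \<beta>) Q (2 * n) \<noteq> 0"
    using A by (intro qpoch_nonzero_powi Q0) auto
  show "Determinant.det (qmat \<alpha> \<beta> Q n) =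
      \<alpha> ^ (n * (n + 1) div 2) * Q ^ (n * (n ^ 2 - 1) div 3) *
      (\<Prod>m=1..n. qpoch Q Q m * qpoch \<alpha> Q m * qpoch \<beta> Q m) /
      (\<Prod>m=1..n. qpoch (\<alpha> * \<beta> * Q powi (int m - 1)) Q m * qpoch (\<alpha> * \<beta>) Q (2 * m))"
    by (rule det_qmat_closed[OF Q0(2) A0])
  \<comment> \<open>The determinant is settled; from here the additional conditions for
    invertibility are in force.\<close>
  assume \<alpha>: "\<alpha> \<noteq> 0"
    and nz: "\<forall>k\<le>n. Q \<noteq> Q powi (- int k) \<and> \<alpha> \<noteq> Q powi (- int k) \<and> \<beta> \<noteq> Q powi (- int k)"
  have \<alpha>\<beta>: "qpoch \<alpha> Q n \<noteq> 0" "qpoch \<beta> Q n \<noteq> 0"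
    by (intro qpoch_nonzero_powi Q0; use nz in simp)+
  have inv: "inverts_mat (qmat \<alpha> \<beta> Q n) (qmat_inv \<alpha> \<beta> Q n)"
      "inverts_mat (qmat_inv \<alpha> \<beta> Q n) (qmat \<alpha> \<beta> Q n)"
    using qmat_inv_eq(2,3)[OF Q0 A0 \<alpha> \<alpha>\<beta>] by (simp_all add: inverts_mat_def qmat_def qmat_inv_def)
  then show "invertible_mat (qmat \<alpha> \<beta> Q n)"
    by (auto simp: invertible_mat_def qmat_def)
  show "let \<Gamma> = Matrix.mat (n + 1) (n + 1) (\<lambda>(j, k). qmat_inv_entry \<alpha> \<beta> Q n j k)
      in inverts_mat (qmat \<alpha> \<beta> Q n) \<Gamma> \<and> inverts_mat \<Gamma> (qmat \<alpha> \<beta> Q n)"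
    using inv by (simp add: qmat_inv_def)
next
  fix \<alpha> \<beta> :: real
  assume ab: "0 < \<alpha>" "\<alpha> < 1" "0 < \<beta>" "\<beta> < 1"
  show "pos_def_mat (qmat \<alpha> \<beta> q n)"
    by (rule pos_def_qmat[OF assms ab])
  show "\<exists>\<mu>. is_smallest_eigenvalue (qmat \<alpha> \<beta> q n) \<mu> \<and>
      \<mu> \<ge> qpoch_inf \<alpha> q / qpoch_inf (\<alpha> * \<beta>) q *
        inverse (\<Sum>l=0..n. (lqj_poly l (-1) \<alpha> \<beta> q) ^ 2 / lqj_norm l \<alpha> \<beta> q)"
    by (rule smallest_eigenvalue_qmat[OF assms ab])
qed

end
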